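(* Let $G$ be a finite simple graph on $n \geq 11$ vertices with independence number $\alpha(G) = 2$. If the maximum degree satisfies $\Delta(G) < 19n/29 - 1$, then $G$ contains a strong immersion of the complete graph $K_{\chi(G)}$, where $\chi(G)$ is the chromatic number of $G$.
   Context: All graphs are finite and simple. An immersion of a graph $H$ in a graph $G$ is a minimal subgraph $I$ of $G$ for which there is an injection $\mathrm{i}\colon V(H)\to V(I)$ and a set of pairwise edge-disjoint paths $\{P_e : e\in E(H)\}$ in $I$ such that the end vertices of $P_{uv}$ are precisely $\mathrm{i}(u)$ and $\mathrm{i}(v)$. The vertices in the image of $\mathrm{i}$ are the branch vertices. The immersion is strong if no internal vertex of any path $P_e$ is a branch vertex. *)

theory Defs
  imports Complex_Main "Graph_Theory.Graph_Theory"
begin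

text \<open>
  A finite simple graph is a \<open>pair_graph\<close>: a finite vertex set with a symmetric, irreflexive
  set of arcs. Every undirected edge \<open>{u, v}\<close> is thus represented by the two arcs
  \<open>(u, v)\<close> and \<open>(v, u)\<close>; edge-disjointness has to refer to undirected edges, not to arcs.
\<close>

definition undirect :: "'a rel \<Rightarrow> 'a set set" where
  "undirect R = (\<lambda>(u, v). {u, v}) ` R"

definition edges :: "'a pair_pre_digraph \<Rightarrow> 'a set set" where
  "edges G = undirect (parcs G)"

definition independent_set :: "'a pair_pre_digraph \<Rightarrow> 'a set \<Rightarrow> bool" where
  "independent_set G S \<longleftrightarrow> S \<subseteq> pverts G \<and> (\<forall>u\<in>S. \<forall>v\<in>S. (u, v) \<notin> parcs G)"

definition independence_number :: "'a pair_pre_digraph \<Rightarrow> nat" where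
  "independence_number G = Max (card ` {S. independent_set G S})"

text \<open>By symmetry of the arcs, out-degree in the digraph is degree in the graph.\<close>

definition max_degree :: "'a pair_pre_digraph \<Rightarrow> nat" where
  "max_degree G = Max (out_degree (with_proj G) ` pverts G)"

definition proper_coloring :: "'a pair_pre_digraph \<Rightarrow> nat \<Rightarrow> ('a \<Rightarrow> nat) \<Rightarrow> bool" where
  "proper_coloring G k c \<longleftrightarrow>
     c ` pverts G \<subseteq> {..<k} \<and> (\<forall>(u, v)\<in>parcs G. c u \<noteq> c v)"

definition chromatic_number :: "'a pair_pre_digraph \<Rightarrow> nat" where
  "chromatic_number G = (LEAST k. \<exists>c. proper_coloring G k c)"

definition complete_graph :: "nat \<Rightarrow> nat pair_pre_digraph" where
  "complete_graph k =
     \<lparr> pverts = {..<k}, parcs = {(u, v). u \<in> {..<k} \<and> v \<in> {..<k} \<and> u \<noteq> v} \<rparr>"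

lemma complete_digraph_complete_graph: "complete_digraph k (with_proj (complete_graph k))"
  unfolding complete_digraph_pair_def by (simp add: complete_graph_def)

text \<open>Paths are nonempty duplicate-free vertex lists whose consecutive vertices are adjacent.\<close>

definition path_edges :: "'a vwalk \<Rightarrow> 'a set set" where
  "path_edges p = undirect (set (vwalk_arcs p))"

definition internal_verts :: "'a vwalk \<Rightarrow> 'a set" where
  "internal_verts p = set (butlast (tl p))"

text \<open>
  \<open>immersion_system H I i P\<close>: \<open>i\<close> and the paths \<open>P e\<close>, for \<open>e \<in> edges H\<close>, realise \<open>H\<close> inside \<open>I\<close>.
  The family \<open>P\<close> is indexed by undirected edges, so there is one path per edge of \<open>H\<close>.
\<close>

definition immersion_system ::
    "'b pair_pre_digraph \<Rightarrow> 'a pair_pre_digraph \<Rightarrow> ('b \<Rightarrow> 'a) \<Rightarrow> ('b set \<Rightarrow> 'a vwalk) \<Rightarrow> bool" where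
  "immersion_system H I i P \<longleftrightarrow>
     inj_on i (pverts H) \<and> i ` pverts H \<subseteq> pverts I \<and>
     (\<forall>e\<in>edges H. vpath (P e) (with_proj I) \<and> {hd (P e), last (P e)} = i ` e) \<and>
     (\<forall>e\<in>edges H. \<forall>f\<in>edges H. e \<noteq> f \<longrightarrow> path_edges (P e) \<inter> path_edges (P f) = {})"

text \<open>
  The branch vertices and the paths are part of the data of an immersion, and \<open>I\<close> is minimal among
  the subgraphs of \<open>G\<close> that carry these data: it has no vertices and edges beyond those that
  \<open>i\<close> and \<open>P\<close> use.
\<close>

definition immersion ::
    "'b pair_pre_digraph \<Rightarrow> 'a pair_pre_digraph \<Rightarrow> 'a pair_pre_digraph \<Rightarrow>
     ('b \<Rightarrow> 'a) \<Rightarrow> ('b set \<Rightarrow> 'a vwalk) \<Rightarrow> bool" where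
  "immersion H G I i P \<longleftrightarrow>
     pair_graph I \<and> subgraph (with_proj I) (with_proj G) \<and> immersion_system H I i P \<and>
     (\<forall>J. pair_graph J \<and> subgraph (with_proj J) (with_proj I) \<and> immersion_system H J i P \<longrightarrow> J = I)"

definition branch_vertices :: "'b pair_pre_digraph \<Rightarrow> ('b \<Rightarrow> 'a) \<Rightarrow> 'a set" where
  "branch_vertices H i = i ` pverts H"

definition strong_immersion ::
    "'b pair_pre_digraph \<Rightarrow> 'a pair_pre_digraph \<Rightarrow> 'a pair_pre_digraph \<Rightarrow>
     ('b \<Rightarrow> 'a) \<Rightarrow> ('b set \<Rightarrow> 'a vwalk) \<Rightarrow> bool" where
  "strong_immersion H G I i P \<longleftrightarrow>
     immersion H G I i P \<and>
     (\<forall>e\<in>edges H. internal_verts (P e) \<inter> branch_vertices H i = {})"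

definition contains_strong_immersion ::
    "'a pair_pre_digraph \<Rightarrow> 'b pair_pre_digraph \<Rightarrow> bool" where
  "contains_strong_immersion G H \<longleftrightarrow> (\<exists>I i P. strong_immersion H G I i P)"

end

theory Submission
  imports Defs
begin

text \<open>
  Let \<open>H\<close> be the complement of \<open>G\<close>. It is triangle-free with minimum degree above \<open>10 n / 29\<close>,
  and cliques of \<open>G\<close> are independent sets of \<open>H\<close>. A maximum matching of \<open>H\<close> is a colouring of
  \<open>G\<close>. If it misses two vertices, then alternating paths and the minimum degree produce an
  independent set of \<open>H\<close> that meets every colour class, hence a clique of \<open>G\<close> with at least
  \<open>\<chi>(G)\<close> vertices. Otherwise \<open>\<chi>(G)\<close> is at most \<open>n / 2\<close>, rounded up, and edges may be added to
  \<open>H\<close> until it is maximal triangle-free.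

  Counting degrees with the weights of the extremal blow-up of the Groetzsch graph shows that
  every independent triple of such an \<open>H\<close> has a common neighbour, and then that the traces
  \<open>N(y) \<inter> N(u)\<close> on a fixed neighbourhood form a cross-free family. Let \<open>u\<close> have maximum degree, and
  let \<open>v\<close> lie in an inclusion-minimal trace. The vertices outside \<open>N(u) \<union> N(v)\<close> are independent and
  their traces form a chain. The branch set is \<open>N(v) \<union> T\<close> with \<open>T\<close> any set of these vertices of the
  right size. By maximality of \<open>|N(u)|\<close> the traces of \<open>T\<close> have distinct representatives \<open>q y\<close>, and a
  pair \<open>y \<in> T\<close>, \<open>x \<in> N(v)\<close> that is not adjacent in \<open>G\<close> is joined by a path \<open>y, w, q y, x\<close> with
  \<open>w \<in> N(u) - N(y)\<close>. As the traces are nested, no edge inside \<open>N(u)\<close> is used twice.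
\<close>

section \<open>Dense triangle-free graphs\<close>

locale triangle_free =
  fixes V :: "'a set" and E :: "'a \<Rightarrow> 'a \<Rightarrow> bool"
  assumes finite_V: "finite V"
    and E_V: "E x y \<Longrightarrow> x \<in> V"
    and E_sym: "E x y \<Longrightarrow> E y x"
    and no_triangle: "E x y \<Longrightarrow> E y z \<Longrightarrow> \<not> E x z"
begin

definition nb :: "'a \<Rightarrow> 'a set" where
  "nb x = {y. E x y}"

lemma in_nb [simp]: "y \<in> nb x \<longleftrightarrow> E x y"
  by (simp add: nb_def)

lemma E_V': "E x y \<Longrightarrow> y \<in> V"
  using E_V E_sym by blast

lemma nb_subset: "nb x \<subseteq> V"
  using E_V' by auto

lemma finite_nb [simp]: "finite (nb x)"
  using nb_subset finite_V by (rule finite_subset)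

lemma E_irrefl [simp]: "\<not> E x x"
  using no_triangle by blast

lemma no_common_nb: "E x y \<Longrightarrow> \<not> (E x w \<and> E y w)"
  using no_triangle E_sym by blast

lemma card_nb: "card (nb x) = (\<Sum>w\<in>V. of_bool (E x w))"
proof -
  have "nb x = V \<inter> {w. E x w}"
    using nb_subset by auto
  then show ?thesis
    using finite_V by (simp add: sum.If_cases of_bool_def)
qed

end

text \<open>Minimum degree above a third of the vertices carries both the hexagon lemma and the
  matching dichotomy. The latter is applied to the complement of the given graph before edges are
  added.\<close>

locale dense_triangle_free = triangle_free +
  assumes dense: "x \<in> V \<Longrightarrow> card V < 3 * card (nb x)"
begin

text \<open>Otherwise every vertex has at most two neighbours on the hexagon.\<close>

lemma hexagon:
  assumes e: "E a b" "E b c" "E c d" "E d e" "E e f" "E f a"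
  shows "(\<exists>w. E a w \<and> E c w \<and> E e w) \<or> (\<exists>w. E b w \<and> E d w \<and> E f w)"
proof (rule ccontr)
  assume neg: "\<not> ?thesis"
  have two: "of_bool (E a w) + of_bool (E b w) + of_bool (E c w) + of_bool (E d w)
      + of_bool (E e w) + of_bool (E f w) \<le> (2::nat)" for w
  proof -
    have "\<not> (E a w \<and> E c w \<and> E e w)" "\<not> (E b w \<and> E d w \<and> E f w)"
      using neg by blast+
    with e[THEN no_common_nb, of w] show ?thesis
      by (cases "E a w"; cases "E b w"; cases "E c w"; cases "E d w"; cases "E e w"; cases "E f w")
        simp_all
  qed
  have "card (nb a) + card (nb b) + card (nb c) + card (nb d) + card (nb e) + card (nb f)
      \<le> (\<Sum>w\<in>V. 2)"
    unfolding card_nb sum.distrib[symmetric] by (rule sum_mono) (rule two)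
  moreover have "card V < 3 * card (nb v)" if "v \<in> {a, b, c, d, e, f}" for v
    using that e E_V dense by blast
  from this[of a] this[of b] this[of c] this[of d] this[of e] this[of f]
  have "2 * card V < card (nb a) + card (nb b) + card (nb c) + card (nb d) + card (nb e) + card (nb f)"
    by simp
  ultimately show False
    by simp
qed

end

text \<open>\<open>common_nb\<close> is edge-maximality in usable form: joining \<open>x\<close> and
  \<open>y\<close> would close a triangle. For \<open>x = y\<close> it says that \<open>x\<close>
  has a neighbour.\<close>

locale maximal_triangle_free = triangle_free +
  assumes dense_29: "x \<in> V \<Longrightarrow> 10 * card V < 29 * card (nb x)"
    and common_nb: "x \<in> V \<Longrightarrow> y \<in> V \<Longrightarrow> \<not> E x y \<Longrightarrow> \<exists>w. E x w \<and> E y w"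
begin

sublocale dense_triangle_free
proof
  fix x assume "x \<in> V"
  from dense_29[OF this] show "card V < 3 * card (nb x)"
    by simp
qed

text \<open>The weights 3, 2, 4 on rim, spokes and hub add up to 29, and no independent set weighs more
  than 10, so the degrees cannot all exceed \<open>10 n / 29\<close>.\<close>

lemma no_groetzsch:
  assumes v: "E v0 v1" "E v1 v2" "E v2 v3" "E v3 v4" "E v4 v0"
    and s: "E s0 v4" "E s0 v1" "E s1 v0" "E s1 v2" "E s2 v1" "E s2 v3" "E s3 v2" "E s3 v4"
      "E s4 v3" "E s4 v0"
    and c: "E c s0" "E c s1" "E c s2" "E c s3" "E c s4"
  shows False
proof -
  have ten: "3 * (of_bool (E v0 w) + of_bool (E v1 w) + of_bool (E v2 w) + of_bool (E v3 w)
        + of_bool (E v4 w))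
      + 2 * (of_bool (E s0 w) + of_bool (E s1 w) + of_bool (E s2 w) + of_bool (E s3 w)
        + of_bool (E s4 w))
      + 4 * of_bool (E c w) \<le> (10::nat)" for w
  proof -
    \<comment> \<open>Once hub and rim are decided, each spoke vertex is either excluded by a
      neighbour or bounded by 1.\<close>
    have le: "of_bool P \<le> (1::nat)" for P
      by simp
    from v[THEN no_common_nb, of w] s[THEN no_common_nb, of w] c[THEN no_common_nb, of w]
      le[of "E s0 w"] le[of "E s1 w"] le[of "E s2 w"] le[of "E s3 w"] le[of "E s4 w"]
    show ?thesis
      by (cases "E c w"; cases "E v0 w"; cases "E v1 w"; cases "E v2 w"; cases "E v3 w";
          cases "E v4 w") simp_all
  qed
  have "3 * (card (nb v0) + card (nb v1) + card (nb v2) + card (nb v3) + card (nb v4))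
      + 2 * (card (nb s0) + card (nb s1) + card (nb s2) + card (nb s3) + card (nb s4))
      + 4 * card (nb c) \<le> (\<Sum>w\<in>V. 10)"
    unfolding card_nb sum.distrib[symmetric] sum_distrib_left by (rule sum_mono) (rule ten)
  moreover have "10 * card V < 29 * card (nb x)"
    if "x \<in> {v0, v1, v2, v3, v4, s0, s1, s2, s3, s4, c}" for x
    using that v s c E_V dense_29 by blast
  from this[of v0] this[of v1] this[of v2] this[of v3] this[of v4]
    this[of s0] this[of s1] this[of s2] this[of s3] this[of s4] this[of c]
  have "29 * (10 * card V) < 29 *
     (3 * (card (nb v0) + card (nb v1) + card (nb v2) + card (nb v3) + card (nb v4))
      + 2 * (card (nb s0) + card (nb s1) + card (nb s2) + card (nb s3) + card (nb s4))
      + 4 * card (nb c))"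
    by simp
  ultimately show False
    by simp
qed

text \<open>The hexagon is \<open>x c y a z b\<close>; the vertices \<open>p\<close>, \<open>q\<close>, \<open>r\<close> are common neighbours of its
  opposite pairs. Any fourth such vertex next to \<open>q\<close> or \<open>r\<close> completes a Groetzsch graph.\<close>

lemma no_hexagon_with_path:
  assumes h: "E a y" "E a z" "E b x" "E b z" "E c x" "E c y" "E d a" "E d b" "E d c"
    and p: "E p x" "E p a" "E q y" "E q b" "E r z" "E r c" "E p q" "E p r"
  shows False
proof -
  have aux: False
    if "E a y" "E a z" "E b x" "E b z" "E c x" "E c y" "E d a" "E d b" "E d c"
      "E p x" "E p a" "E q y" "E q b" "E r z" "E r c" "E p q" "E p r"
      "E y q'" "E b q'" "E r q'"
    for a b c d p q r x y z q'
    \<comment> \<open>Rim \<open>y a p r c\<close>, spokes \<open>d q z x q'\<close>, hub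
      \<open>b\<close>.\<close>
    by (rule no_groetzsch[of y a p r c d q z x q' b]) (simp_all add: that that[THEN E_sym])
  \<comment> \<open>The hexagon is \<open>y q b z r c\<close>. Its two outcomes are interchanged by
    swapping \<open>y\<close> with \<open>z\<close>, \<open>b\<close> with \<open>c\<close> and
    \<open>q\<close> with \<open>r\<close>.\<close>
  have "(\<exists>w. E y w \<and> E b w \<and> E r w) \<or> (\<exists>w. E q w \<and> E z w \<and> E c w)"
    by (rule hexagon) (simp_all add: h p h[THEN E_sym] p[THEN E_sym])
  then show False
  proof (elim disjE exE conjE)
    fix w
    assume w: "E y w" "E b w" "E r w"
    show False
      by (rule aux[of a y z b x c d p q r w]) (simp_all add: h p w)
  next
    fix w
    assume w: "E q w" "E z w" "E c w"
    show False
      by (rule aux[of a z y c x b d p r q w]) (simp_all add: h p w)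
  qed
qed

text \<open>Otherwise the common neighbours \<open>a\<close>, \<open>b\<close>, \<open>c\<close> of
  the pairs span a hexagon with the triple, and opposite vertices of it have common neighbours
  \<open>p\<close>, \<open>q\<close>, \<open>r\<close>. Further hexagons make any two of these
  adjacent after replacing one of them, while one that is adjacent to both others is excluded by
  \<open>no_hexagon_with_path\<close>.\<close>

lemma common_nb_3:
  assumes V: "x \<in> V" "y \<in> V" "z \<in> V" and n: "\<not> E x y" "\<not> E x z" "\<not> E y z"
  shows "\<exists>w. E x w \<and> E y w \<and> E z w"
proof (rule ccontr)
  assume neg: "\<not> ?thesis"
  obtain a where a: "E y a" "E z a"
    using common_nb V n by blast
  obtain b where b: "E x b" "E z b"
    using common_nb V n by blast
  obtain c where c: "E x c" "E y c"
    using common_nb V n by blast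
  note abc = a b c a[THEN E_sym] b[THEN E_sym] c[THEN E_sym]
  have "(\<exists>w. E x w \<and> E y w \<and> E z w) \<or> (\<exists>w. E c w \<and> E a w \<and> E b w)"
    by (rule hexagon) (simp_all add: abc)
  then obtain d where d: "E a d" "E b d" "E c d"
    using neg by blast
  note abcd = abc d d[THEN E_sym]
  have n': "\<not> E x a" "\<not> E y b" "\<not> E z c"
    using neg a b c by blast+
  have V': "a \<in> V" "b \<in> V" "c \<in> V"
    using a b c E_V' by blast+
  obtain p where p: "E x p" "E a p"
    using common_nb[OF V(1) V'(1) n'(1)] by blast
  obtain q where q: "E y q" "E b q"
    using common_nb[OF V(2) V'(2) n'(2)] by blast
  obtain r where r: "E z r" "E c r"
    using common_nb[OF V(3) V'(3) n'(3)] by blast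
  \<comment> \<open>The hexagon \<open>x p a y q b\<close>: either a new choice of \<open>p\<close>
    is adjacent to \<open>q\<close>, or a new choice of \<open>q\<close> is adjacent to
    \<open>p\<close>.\<close>
  have pq: "(\<exists>w. E x w \<and> E a w \<and> E q w) \<or> (\<exists>w. E p w \<and> E y w \<and> E b w)"
    if "E x p" "E a p" "E y q" "E b q" for p q
    by (rule hexagon) (simp_all add: abc that that[THEN E_sym])
  have pr: "(\<exists>w. E x w \<and> E a w \<and> E r w) \<or> (\<exists>w. E p w \<and> E z w \<and> E c w)"
    if "E x p" "E a p" "E z r" "E c r" for p r
    by (rule hexagon) (simp_all add: abc that that[THEN E_sym])
  have qr: "(\<exists>w. E y w \<and> E b w \<and> E r w) \<or> (\<exists>w. E q w \<and> E z w \<and> E c w)"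
    if "E y q" "E b q" "E z r" "E c r" for q r
    by (rule hexagon) (simp_all add: abc that that[THEN E_sym])
  have center_p: False if "E x p" "E a p" "E y q" "E b q" "E z r" "E c r" "E p q" "E p r" for p q r
    by (rule no_hexagon_with_path[of a y z b x c d p q r])
      (simp_all add: abcd that that[THEN E_sym])
  have center_q: False if "E x p" "E a p" "E y q" "E b q" "E z r" "E c r" "E q p" "E q r" for p q r
    by (rule no_hexagon_with_path[of b x z a y c d q p r])
      (simp_all add: abcd that that[THEN E_sym])
  have center_r: False if "E x p" "E a p" "E y q" "E b q" "E z r" "E c r" "E r p" "E r q" for p q r
    by (rule no_hexagon_with_path[of c x y a z b d r p q])
      (simp_all add: abcd that that[THEN E_sym])
  \<comment> \<open>As \<open>q'\<close> and \<open>r'\<close> are adjacent, no choice of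
    \<open>p\<close> is adjacent to either. The alternatives must therefore replace
    \<open>q'\<close> and \<open>r'\<close> by neighbours of the original \<open>p\<close>.\<close>
  obtain q' r' where qr': "E y q'" "E b q'" "E z r'" "E c r'" "E q' r'" "E r' q'"
    using qr[OF q r] q r E_sym[of q] E_sym[of r] by blast
  have "\<not> (E x w \<and> E a w \<and> E q' w)" "\<not> (E x w \<and> E a w \<and> E r' w)" for w
    using center_q[of w q' r'] center_r[of w q' r'] qr' by blast+
  then obtain q'' r'' where "E p q''" "E y q''" "E b q''" "E p r''" "E z r''" "E c r''"
    using pq[OF p qr'(1,2)] pr[OF p qr'(3,4)] by blast
  then show False
    using center_p[of p q'' r''] p by blast
qed

text \<open>Common neighbours of four independent triples complete the configuration to a Groetzsch
  graph. The vertices \<open>w\<close>, \<open>q\<close>, \<open>r\<close>, \<open>v\<close> witness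
  that the traces of \<open>y\<close> and \<open>z\<close> on \<open>nb u\<close> meet, that neither
  contains the other, and that they do not cover \<open>nb u\<close>.\<close>

lemma cross_free:
  assumes I: "E u v" "E u w" "E u q" "E u r"
    and y: "E y w" "E y q" "\<not> E y v" "\<not> E y r"
    and z: "E z w" "E z r" "\<not> E z v" "\<not> E z q"
  shows False
proof -
  note E = I y(1,2) z(1,2) I[THEN E_sym] y(1,2)[THEN E_sym] z(1,2)[THEN E_sym]
  have V: "v \<in> V" "w \<in> V" "q \<in> V" "r \<in> V" "y \<in> V" "z \<in> V"
    using E E_V by blast+
  have n: "\<not> E v q" "\<not> E v r" "\<not> E y z" "\<not> E v y" "\<not> E v z" "\<not> E r y" "\<not> E q z"
    using y z E no_triangle E_sym[of v y] E_sym[of v z] E_sym[of r y] E_sym[of q z] by blast+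
  obtain s where s: "E v s" "E q s" "E z s"
    using common_nb_3[OF V(1,3,6) n(1,5,7)] by blast
  obtain g where g: "E v g" "E r g" "E y g"
    using common_nb_3[OF V(1,4,5) n(2,4,6)] by blast
  obtain h where h: "E v h" "E y h" "E z h"
    using common_nb_3[OF V(1,5,6) n(4,5,3)] by blast
  have g': "\<not> E q g" "\<not> E z g" "g \<in> V"
    using g E no_triangle E_V' by blast+
  obtain k where k: "E q k" "E z k" "E g k"
    using common_nb_3[OF V(3,6) g'(3) n(7) g'(1,2)] by blast
  show False
    \<comment> \<open>Rim \<open>u v g y q\<close>, spokes \<open>s r h k w\<close>, hub
      \<open>z\<close>.\<close>
    by (rule no_groetzsch[of u v g y q s r h k w z])
      (simp_all add: E s g h k s[THEN E_sym] g[THEN E_sym] h[THEN E_sym] k[THEN E_sym])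
qed

end

text \<open>In a triangle-free supergraph on \<open>V\<close> with the most edges, a nonadjacent
  pair without a common neighbour could still be joined. Degrees only grow, so the density bound
  survives.\<close>

lemma (in triangle_free) exists_maximal_triangle_free:
  assumes dense_29: "\<And>x. x \<in> V \<Longrightarrow> 10 * card V < 29 * card (nb x)"
  obtains E' where "maximal_triangle_free V E'" "\<And>x y. E x y \<Longrightarrow> E' x y"
proof -
  define ext where "ext R \<longleftrightarrow> R \<subseteq> V \<times> V \<and> {(x, y). E x y} \<subseteq> R \<and> sym R \<and>
    (\<forall>x y z. (x, y) \<in> R \<longrightarrow> (y, z) \<in> R \<longrightarrow> (x, z) \<notin> R)" for R
  have "ext {(x, y). E x y}"
    unfolding ext_def
  proof (intro conjI allI impI)
    show "{(x, y). E x y} \<subseteq> V \<times> V"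
      using E_V E_V' by blast
    show "sym {(x, y). E x y}"
      unfolding sym_def mem_Collect_eq case_prod_conv by (intro allI impI) (rule E_sym)
    show "(x, z) \<notin> {(x, y). E x y}" if "(x, y) \<in> {(x, y). E x y}" "(y, z) \<in> {(x, y). E x y}"
      for x y z
      using no_triangle that by simp
  qed simp
  moreover have bound: "card R \<le> card (V \<times> V)" if "ext R" for R
    using that finite_V by (intro card_mono) (auto simp: ext_def)
  ultimately obtain R where R: "ext R" and max: "\<And>R'. ext R' \<Longrightarrow> card R' \<le> card R"
    using ex_has_greatest_nat[of ext _ card "Suc (card (V \<times> V))"] by (metis le_imp_less_Suc)
  have RV: "R \<subseteq> V \<times> V" and ER: "{(x, y). E x y} \<subseteq> R" and Rsym: "sym R"
    and Rtri: "\<And>x y z. (x, y) \<in> R \<Longrightarrow> (y, z) \<in> R \<Longrightarrow> (x, z) \<notin> R"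
    using R unfolding ext_def by blast+
  have finR: "finite R"
    using RV finite_V by (meson finite_SigmaI finite_subset)
  have tf: "triangle_free V (\<lambda>x y. (x, y) \<in> R)"
  proof
    show "x \<in> V" if "(x, y) \<in> R" for x y
      using RV that by blast
    show "(y, x) \<in> R" if "(x, y) \<in> R" for x y
      using Rsym that by (rule symD)
    show "(x, z) \<notin> R" if "(x, y) \<in> R" "(y, z) \<in> R" for x y z
      using that by (rule Rtri)
  qed (rule finite_V)
  have nb_sub: "nb x \<subseteq> triangle_free.nb (\<lambda>x y. (x, y) \<in> R) x" for x
    using ER by (auto simp: triangle_free.nb_def[OF tf] nb_def)
  have "maximal_triangle_free V (\<lambda>x y. (x, y) \<in> R)"
  proof (intro maximal_triangle_free.intro[OF tf] maximal_triangle_free_axioms.intro)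
    fix x
    assume x: "x \<in> V"
    have "card (nb x) \<le> card (triangle_free.nb (\<lambda>x y. (x, y) \<in> R) x)"
      by (intro card_mono nb_sub triangle_free.finite_nb[OF tf])
    with dense_29[OF x] show "10 * card V < 29 * card (triangle_free.nb (\<lambda>x y. (x, y) \<in> R) x)"
      by linarith
    fix y
    assume y: "y \<in> V" and xy: "(x, y) \<notin> R"
    show "\<exists>w. (x, w) \<in> R \<and> (y, w) \<in> R"
    proof (cases "x = y")
      case True
      have "nb x \<noteq> {}"
        using dense_29[OF x] by auto
      then obtain w where "E x w"
        by auto
      then show ?thesis
        using True ER by blast
    next
      case False
      show ?thesis
      proof (rule ccontr)
        assume no: "\<not> ?thesis"
        have yx: "(y, x) \<notin> R"
          using xy symD[OF Rsym] by blast
        have loop: "(z, z) \<notin> R" for z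
          using Rtri by blast
        define R' where "R' = R \<union> {(x, y), (y, x)}"
        have no': "\<not> ((x, w) \<in> R \<and> (y, w) \<in> R)" "\<not> ((w, x) \<in> R \<and> (y, w) \<in> R)"
          "\<not> ((x, w) \<in> R \<and> (w, y) \<in> R)" "\<not> ((w, x) \<in> R \<and> (w, y) \<in> R)" for w
          using no symD[OF Rsym, of w x] symD[OF Rsym, of w y] by blast+
        have tri': "(a, c) \<notin> R'" if abc: "(a, b) \<in> R'" "(b, c) \<in> R'" for a b c
        proof
          assume ac: "(a, c) \<in> R'"
          have R'_iff: "(s, t) \<in> R' \<longleftrightarrow> (s, t) \<in> R \<or> s = x \<and> t = y \<or> s = y \<and> t = x" for s t
            by (auto simp: R'_def)
          show False
            using abc ac unfolding R'_iff
            by (elim disjE conjE) (use Rtri[of a b c] no' loop xy yx False in \<open>blast+\<close>)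
        qed
        moreover have "R' \<subseteq> V \<times> V" "{(x, y). E x y} \<subseteq> R'" "sym R'"
        proof -
          show "R' \<subseteq> V \<times> V" "{(x, y). E x y} \<subseteq> R'"
            using RV ER x y by (auto simp: R'_def)
          show "sym R'"
            unfolding R'_def by (intro sym_Un Rsym) (auto simp: sym_def)
        qed
        ultimately have "ext R'"
          unfolding ext_def by blast
        from max[OF this] have "card R' \<le> card R" .
        moreover have "card R < card R'"
          unfolding R'_def using finR xy by (intro psubset_card_mono) auto
        ultimately show False
          by simp
      qed
    qed
  qed
  with ER that show ?thesis
    by blast
qed

section \<open>A linked set of half the vertices\<close>

definition pairs :: "'a set \<Rightarrow> 'a set set" where
  "pairs S = {{x, y} |x y. x \<in> S \<and> y \<in> S \<and> x \<noteq> y}"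

lemma chain_distinct_representatives:
  assumes "finite T"
    and "\<And>y. y \<in> T \<Longrightarrow> finite (X y)"
    and "\<And>y z. y \<in> T \<Longrightarrow> z \<in> T \<Longrightarrow> X y \<subseteq> X z \<or> X z \<subseteq> X y"
    and "\<And>y. y \<in> T \<Longrightarrow> card {z \<in> T. X z \<subseteq> X y} \<le> card (X y)"
  shows "\<exists>q. inj_on q T \<and> (\<forall>y\<in>T. q y \<in> X y)"
  using assms
proof (induction "card T" arbitrary: T)
  case 0
  then show ?case
    by simp
next
  case (Suc n)
  then have "T \<noteq> {}"
    by auto
  then obtain y where y: "y \<in> T" and max: "\<And>z. z \<in> T \<Longrightarrow> card (X z) \<le> card (X y)"
    using obtains_MAX[of T "\<lambda>y. card (X y)"] Suc.prems(1) Max_ge[of "(\<lambda>y. card (X y)) ` T"]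
    by (metis finite_imageI image_eqI)
  have sub: "X z \<subseteq> X y" if "z \<in> T" for z
    using Suc.prems(2)[OF that] Suc.prems(3)[OF that y] max[OF that] by (metis card_seteq)
  have "\<exists>q. inj_on q (T - {y}) \<and> (\<forall>z\<in>T - {y}. q z \<in> X z)"
  proof (rule Suc.hyps(1))
    fix z
    assume z: "z \<in> T - {y}"
    have "card {z' \<in> T - {y}. X z' \<subseteq> X z} \<le> card {z' \<in> T. X z' \<subseteq> X z}"
      by (rule card_mono) (use Suc.prems(1) in auto)
    also have "\<dots> \<le> card (X z)"
      using Suc.prems(4) z by blast
    finally show "card {z' \<in> T - {y}. X z' \<subseteq> X z} \<le> card (X z)" .
  qed (use Suc.hyps(2) Suc.prems y in auto)
  then obtain q where q: "inj_on q (T - {y})" "\<forall>z\<in>T - {y}. q z \<in> X z"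
    by blast
  have "card (q ` (T - {y})) < card T"
    using y Suc.prems(1) by (metis card_image card_Diff1_less q(1))
  also have "card T = card {z \<in> T. X z \<subseteq> X y}"
    using sub by (intro arg_cong[of _ _ card]) blast
  also have "\<dots> \<le> card (X y)"
    using Suc.prems(4) y by blast
  finally have "\<not> X y \<subseteq> q ` (T - {y})"
    using Suc.prems(1) by (meson card_mono finite_Diff finite_imageI leD)
  then obtain x where x: "x \<in> X y" "x \<notin> q ` (T - {y})"
    by blast
  have "inj_on (q(y := x)) (insert y (T - {y}))"
    using q(1) x(2) by (auto simp: inj_on_def)
  then have "inj_on (q(y := x)) T"
    using y by (simp add: insert_absorb)
  moreover have "\<forall>z\<in>T. (q(y := x)) z \<in> X z"
    using q(2) x(1) by auto
  ultimately show ?case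
    by blast
qed

text \<open>\<open>I\<close> separates inner vertices from ends, so an outer edge never equals a
  middle one; \<open>y \<noteq> x'\<close> and \<open>y' \<noteq> x\<close> separate first edges
  from last ones.\<close>

lemma three_edge_paths_disjoint:
  assumes "W \<in> I" "W' \<in> I" "Q \<in> I" "Q' \<in> I" "y \<notin> I" "y' \<notin> I" "x \<notin> I" "x' \<notin> I"
    and "y \<noteq> x'" "y' \<noteq> x"
    and "y = y' \<Longrightarrow> W \<noteq> W'" "Q = Q' \<Longrightarrow> y = y'" "\<not> (W = Q' \<and> Q = W')" "{y, x} \<noteq> {y', x'}"
  shows "{{y, W}, {W, Q}, {Q, x}} \<inter> {{y', W'}, {W', Q'}, {Q', x'}} = {}"
proof -
  have "y \<noteq> W'" "y \<noteq> Q'" "y' \<noteq> W" "y' \<noteq> Q" "x \<noteq> W'" "x \<noteq> Q'" "x' \<noteq> W" "x' \<noteq> Q"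
    using assms(1-8) by blast+
  then have "{y, W} \<noteq> {y', W'}" "{y, W} \<noteq> {W', Q'}" "{y, W} \<noteq> {Q', x'}"
    "{W, Q} \<noteq> {y', W'}" "{W, Q} \<noteq> {W', Q'}" "{W, Q} \<noteq> {Q', x'}"
    "{Q, x} \<noteq> {y', W'}" "{Q, x} \<noteq> {W', Q'}" "{Q, x} \<noteq> {Q', x'}"
    using assms(9-) unfolding doubleton_eq_iff by blast+
  then show ?thesis
    by simp
qed

context triangle_free
begin

text \<open>This is a strong clique immersion in the complement of \<open>E\<close> with branch set
  \<open>S\<close>, stated without subgraphs. Inner vertices avoid all of \<open>S\<close>, so the
  property passes to smaller branch sets.\<close>

definition linked :: "'a set \<Rightarrow> bool" where
  "linked S \<longleftrightarrow> (\<exists>P.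
     (\<forall>e\<in>pairs S. P e \<noteq> [] \<and> distinct (P e) \<and> set (P e) \<subseteq> V \<and>
        successively (\<lambda>x y. \<not> E x y) (P e) \<and> {hd (P e), last (P e)} = e \<and>
        internal_verts (P e) \<inter> S = {}) \<and>
     (\<forall>e\<in>pairs S. \<forall>f\<in>pairs S. e \<noteq> f \<longrightarrow> path_edges (P e) \<inter> path_edges (P f) = {}))"

end

section \<open>Traces on a fixed neighbourhood\<close>

context maximal_triangle_free
begin

text \<open>The traces meet by \<open>common_nb_3\<close> and both miss \<open>v\<close>, so
  \<open>cross_free\<close> leaves only inclusion.\<close>

lemma traces_nested:
  assumes "E u v" "y \<in> V" "z \<in> V" "\<not> E u y" "\<not> E u z" "\<not> E y z" "\<not> E y v" "\<not> E z v"
  shows "nb u \<inter> nb y \<subseteq> nb u \<inter> nb z \<or> nb u \<inter> nb z \<subseteq> nb u \<inter> nb y"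
proof (rule ccontr)
  assume "\<not> ?thesis"
  then obtain q r where qr: "E u q" "E y q" "\<not> E z q" "E u r" "E z r" "\<not> E y r"
    unfolding subset_iff Int_iff in_nb by blast
  obtain w where w: "E u w" "E y w" "E z w"
    using common_nb_3[of u y z] assms E_V[OF assms(1)] by blast
  show False
    by (rule cross_free[of u v w q r y z]) (use assms qr w in auto)
qed

text \<open>\<open>v\<close> is taken from a smallest trace, that of \<open>z0\<close>. A trace
  avoiding \<open>v\<close> has an element outside it, so by \<open>cross_free\<close> its vertex is
  adjacent to \<open>z0\<close> or the two traces cover \<open>nb u\<close>. An edge outside
  \<open>nb u\<close> and \<open>nb v\<close> rules out covering at both ends and so forms a
  triangle with \<open>z0\<close>.\<close>

lemma exists_splitting_vertex:
  assumes u: "u \<in> V"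
  obtains v where "E u v" "\<And>y z. y \<in> V - nb u - nb v \<Longrightarrow> z \<in> V - nb u - nb v \<Longrightarrow> \<not> E y z"
proof -
  have "u \<in> V - nb u"
    using u by simp
  then obtain z0 where z0: "z0 \<in> V - nb u"
    and min: "\<And>z. z \<in> V - nb u \<Longrightarrow> card (nb u \<inter> nb z0) \<le> card (nb u \<inter> nb z)"
    using ex_has_least_nat[of "\<lambda>z. z \<in> V - nb u" u "\<lambda>z. card (nb u \<inter> nb z)"] by blast
  obtain v where v: "E u v" "E z0 v"
    using common_nb[OF u] z0 by auto
  have cases: "E z0 y \<or> nb u \<subseteq> nb z0 \<union> nb y" and new: "\<exists>q. E u q \<and> E y q \<and> \<not> E z0 q"
    if y: "y \<in> V - nb u - nb v" for y
  proof -
    have vy: "\<not> E y v"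
      using y E_sym[of y v] by auto
    have "\<not> nb u \<inter> nb y \<subset> nb u \<inter> nb z0"
      using min[of y] y psubset_card_mono[of "nb u \<inter> nb z0" "nb u \<inter> nb y"] by fastforce
    then show q: "\<exists>q. E u q \<and> E y q \<and> \<not> E z0 q"
      using v vy by auto
    show "E z0 y \<or> nb u \<subseteq> nb z0 \<union> nb y"
    proof (rule ccontr)
      assume neg: "\<not> ?thesis"
      then obtain x where x: "E u x" "\<not> E z0 x" "\<not> E y x"
        unfolding subset_iff Un_iff in_nb by blast
      obtain w where w: "E u w" "E z0 w" "E y w"
        using common_nb_3[of u z0 y] u z0 y neg by auto
      from q obtain q where "E u q" "E y q" "\<not> E z0 q"
        by blast
      then show False
        using cross_free[of u x w v q z0 y] v vy x w by blast
    qed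
  qed
  have "\<not> E y z" if y: "y \<in> V - nb u - nb v" and z: "z \<in> V - nb u - nb v" for y z
  proof
    assume yz: "E y z"
    have "E z0 y" if e: "E y z" "y \<in> V - nb u - nb v" "z \<in> V - nb u - nb v" for y z
    proof -
      obtain q where q: "E u q" "E z q" "\<not> E z0 q"
        using new[OF e(3)] by blast
      then have "\<not> E y q"
        using no_triangle e(1) by blast
      with q have "\<not> nb u \<subseteq> nb z0 \<union> nb y"
        by auto
      then show ?thesis
        using cases[OF e(2)] by blast
    qed
    from this[OF yz y z] this[OF E_sym[OF yz] z y] show False
      using no_triangle yz by blast
  qed
  with v that show ?thesis
    by blast
qed

text \<open>A vertex \<open>p\<close> adjacent to \<open>y\<close> with the largest possible trace is adjacent to all of
  \<open>nb u - nb y\<close> and to all vertices with a smaller trace than \<open>y\<close>; its degree gives the bound.\<close>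

lemma card_smaller_traces:
  assumes uv: "E u v" and max: "\<And>x. x \<in> V \<Longrightarrow> card (nb x) \<le> card (nb u)"
    and y: "y \<in> V - nb u - nb v"
  shows "card {z \<in> V - nb u - nb v. nb u \<inter> nb z \<subseteq> nb u \<inter> nb y} \<le> card (nb u \<inter> nb y)"
proof -
  define J where "J = nb u - nb y"
  have V: "u \<in> V" "v \<in> V" "y \<in> V"
    using uv y E_V E_V' by auto
  have vy: "\<not> E y v" "\<not> E u y"
    using y E_sym[of y v] by auto
  have finJ: "finite (nb p \<inter> J)" for p
    by simp
  \<comment> \<open>\<open>p1\<close> guarantees that the maximal \<open>p\<close> meets
    \<open>J\<close>, since \<open>v\<close> lies in both \<open>nb p1\<close> and
    \<open>J\<close>.\<close>
  obtain p1 where p1: "E y p1" "E v p1"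
    using common_nb[OF V(3,2) vy(1)] by blast
  obtain p where p: "E y p" and pmax: "\<And>p'. E y p' \<Longrightarrow> card (nb p' \<inter> J) \<le> card (nb p \<inter> J)"
  proof -
    have "card (nb p' \<inter> J) < Suc (card V)" for p'
      using card_mono[OF finite_V, of "nb p' \<inter> J"] nb_subset[of p'] by (simp add: le_infI1 less_Suc_eq_le)
    with ex_has_greatest_nat[of "E y" p1 "\<lambda>p. card (nb p \<inter> J)" "Suc (card V)"] p1 that
    show ?thesis
      by blast
  qed
  have "v \<in> nb p1 \<inter> J"
    using E_sym[OF p1(2)] uv vy by (simp add: J_def)
  then have "card (nb p1 \<inter> J) \<noteq> 0"
    by (auto simp: finJ)
  then obtain r0 where r0: "E p r0" "r0 \<in> J"
    using pmax[OF p1(1)] by (metis Int_iff card_eq_0_iff disjoint_iff finJ in_nb le_0_eq)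
  have up: "\<not> E u p"
    using r0 no_triangle[of u p r0] by (auto simp: J_def)
  obtain e where e: "E u e" "E y e"
    using common_nb[of u y] V vy by blast
  have pJ: "J \<subseteq> nb p"
  proof
    fix r
    assume r: "r \<in> J"
    show "r \<in> nb p"
    proof (rule ccontr)
      assume rp: "r \<notin> nb p"
      have "r \<in> V" "r0 \<in> V" "\<not> E y r" "\<not> E y r0" "\<not> E r r0"
        using r r0 E_V'[of u] no_triangle[of u r r0] by (auto simp: J_def)
      then obtain s where s: "E y s" "E r s" "E r0 s"
        using common_nb_3[of y r r0] V by blast
      have "\<not> nb p \<inter> J \<subset> nb s \<inter> J"
        using pmax[OF s(1)] psubset_card_mono[OF finJ] by (meson leD)
      moreover have "r \<in> nb s \<inter> J"
        using E_sym[OF s(2)] r by simp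
      ultimately have "\<not> nb p \<inter> J \<subseteq> nb s"
        using rp by blast
      then obtain q where q: "E p q" "q \<in> J" "\<not> E s q"
        unfolding subset_iff Int_iff in_nb by blast
      have "\<not> E p e" "\<not> E s e"
        using e(2) no_triangle[OF p] no_triangle[OF s(1)] by blast+
      \<comment> \<open>On \<open>nb u\<close>, \<open>e\<close> is in neither trace of
        \<open>p\<close> and \<open>s\<close>, \<open>r0\<close> is in both, \<open>q\<close> only
        in that of \<open>p\<close>, and \<open>r\<close> only in that of \<open>s\<close>.\<close>
      then show False
        using cross_free[of u e r0 q r p s] e r0 r q rp E_sym[OF s(2)] E_sym[OF s(3)]
        by (auto simp: J_def)
    qed
  qed
  have pC: "{z \<in> V - nb u - nb v. nb u \<inter> nb z \<subseteq> nb u \<inter> nb y} \<subseteq> nb p" (is "?C \<subseteq> _")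
  proof
    fix z
    assume z: "z \<in> ?C"
    show "z \<in> nb p"
    proof (rule ccontr)
      assume "z \<notin> nb p"
      \<comment> \<open>\<open>w\<close> lies in the trace of \<open>z\<close>, hence in
        \<open>nb y\<close>, and closes a triangle with \<open>y\<close> and
        \<open>p\<close>.\<close>
      then obtain w where "E u w" "E p w" "E z w"
        using common_nb_3[of u p z] up z V p E_V' by auto
      then show False
        using z no_triangle[OF p, of w] by auto
    qed
  qed
  have "card J + card ?C = card (J \<union> ?C)"
    using finite_V by (intro card_Un_disjoint[symmetric]) (auto simp: J_def)
  also have "\<dots> \<le> card (nb p)"
    using pJ pC by (intro card_mono) auto
  also have "\<dots> \<le> card (nb u)"
    using max p E_V' by blast
  also have "\<dots> = card J + card (nb u \<inter> nb y)"
    unfolding J_def by (metis add.commute card_Int_Diff finite_nb)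
  finally show ?thesis
    by simp
qed


text \<open>Both \<open>nb v\<close> and \<open>T\<close> are independent, so only pairs between
  them can be adjacent in \<open>E\<close> and require a long path. All inner vertices lie in
  \<open>nb u\<close>, which is disjoint from the branch set.\<close>

lemma linked_half:
  assumes "V \<noteq> {}" and small: "\<And>x. x \<in> V \<Longrightarrow> 2 * card (nb x) < card V"
  shows "\<exists>S\<subseteq>V. card S = (card V + 1) div 2 \<and> linked S"
proof -
  obtain u where u: "u \<in> V" and max: "\<And>x. x \<in> V \<Longrightarrow> card (nb x) \<le> card (nb u)"
  proof -
    obtain x where "x \<in> V"
      using assms(1) by blast
    with ex_has_greatest_nat[of "\<lambda>x. x \<in> V" x "\<lambda>x. card (nb x)" "card V"] small that
    show ?thesis
      by fastforce
  qed
  obtain v where uv: "E u v"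
    and indep: "\<And>y z. y \<in> V - nb u - nb v \<Longrightarrow> z \<in> V - nb u - nb v \<Longrightarrow> \<not> E y z"
    using exists_splitting_vertex[OF u] by blast
  define C where "C = V - nb u - nb v"
  have disj: "nb u \<inter> nb v = {}"
    using no_triangle[OF uv] by auto
  have "card C = card V - card (nb u) - card (nb v)"
  proof -
    have "nb v \<subseteq> V - nb u"
      using disj nb_subset by blast
    then show ?thesis
      unfolding C_def by (simp add: card_Diff_subset nb_subset)
  qed
  \<comment> \<open>Degrees below one half make \<open>C\<close> large enough to contain
    \<open>T\<close> and keep the subtraction in the size of \<open>T\<close> from being
    truncated.\<close>
  moreover have u2: "2 * card (nb u) < card V" "2 * card (nb v) < card V"
    using small u uv E_V' by blast+
  ultimately have "(card V + 1) div 2 - card (nb v) \<le> card C"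
    by linarith
  then obtain T where T: "T \<subseteq> C" "card T = (card V + 1) div 2 - card (nb v)"
    by (meson obtain_subset_with_card_n)
  have finT: "finite T"
    using T(1) finite_V by (auto simp: C_def intro: finite_subset)
  define S where "S = nb v \<union> T"
  have TA: "nb v \<inter> T = {}" and TI: "nb u \<inter> T = {}"
    using T(1) by (auto simp: C_def)
  have "card S = (card V + 1) div 2"
    unfolding S_def using T(2) TA u2(2) finT by (simp add: card_Un_disjoint)
  moreover have "S \<subseteq> V"
    using T(1) nb_subset by (auto simp: S_def C_def)
  moreover have "linked S"
  proof -
    have nested: "nb u \<inter> nb y \<subseteq> nb u \<inter> nb z \<or> nb u \<inter> nb z \<subseteq> nb u \<inter> nb y" if "y \<in> T" "z \<in> T" for y z
    proof -
      have "y \<in> V - nb u - nb v" "z \<in> V - nb u - nb v"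
        using that T(1) by (auto simp: C_def)
      with traces_nested[OF uv, of y z] indep[of y z] show ?thesis
        using E_sym[of y v] E_sym[of z v] by auto
    qed
    have "card {z \<in> T. nb u \<inter> nb z \<subseteq> nb u \<inter> nb y} \<le> card (nb u \<inter> nb y)" if "y \<in> T" for y
    proof -
      have "card {z \<in> T. nb u \<inter> nb z \<subseteq> nb u \<inter> nb y} \<le> card {z \<in> C. nb u \<inter> nb z \<subseteq> nb u \<inter> nb y}"
        using T(1) finite_V by (intro card_mono) (auto simp: C_def)
      also have "\<dots> \<le> card (nb u \<inter> nb y)"
        unfolding C_def using card_smaller_traces[OF uv max] that T(1) by (auto simp: C_def)
      finally show ?thesis .
    qed
    with chain_distinct_representatives[of T "\<lambda>y. nb u \<inter> nb y"] finT nested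
    obtain q where q_inj: "inj_on q T" and q: "\<And>y. y \<in> T \<Longrightarrow> E u (q y) \<and> E y (q y)"
      by auto
    \<comment> \<open>There is room for \<open>w\<close>: the traces of \<open>y\<close> on
      \<open>nb u\<close> and \<open>nb v\<close> are disjoint, and \<open>y\<close> has no larger
      degree than \<open>u\<close>. Injectivity separates the first edges of paths starting at the
      same \<open>y\<close>.\<close>
    have "\<exists>w. inj_on w (nb y \<inter> nb v) \<and> w ` (nb y \<inter> nb v) \<subseteq> nb u - nb y" if "y \<in> T" for y
    proof (rule inj_on_iff_card_le[THEN iffD2])
      have "card (nb u \<inter> nb y) + card (nb y \<inter> nb v) = card (nb u \<inter> nb y \<union> nb y \<inter> nb v)"
        using disj by (intro card_Un_disjoint[symmetric]) auto
      also have "\<dots> \<le> card (nb y)"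
        by (intro card_mono) auto
      also have "\<dots> \<le> card (nb u)"
        using max that T(1) by (auto simp: C_def)
      also have "\<dots> = card (nb u - nb y) + card (nb u \<inter> nb y)"
        by (metis add.commute card_Int_Diff finite_nb)
      finally show "card (nb y \<inter> nb v) \<le> card (nb u - nb y)"
        by simp
    qed auto
    then have "\<forall>y\<in>T. \<exists>w. inj_on w (nb y \<inter> nb v) \<and> w ` (nb y \<inter> nb v) \<subseteq> nb u - nb y"
      by blast
    then obtain w where
      w': "\<forall>y\<in>T. inj_on (w y) (nb y \<inter> nb v) \<and> w y ` (nb y \<inter> nb v) \<subseteq> nb u - nb y"
      by (rule bchoice[THEN exE])
    then have w_inj: "inj_on (w y) (nb y \<inter> nb v)" if "y \<in> T" for y
      using that by blast
    have w: "E u (w y x) \<and> \<not> E y (w y x)" if "y \<in> T" "E v x" "E y x" for y x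
    proof -
      have "w y ` (nb y \<inter> nb v) \<subseteq> nb u - nb y"
        using w' that(1) by blast
      moreover have "x \<in> nb y \<inter> nb v"
        using that by simp
      ultimately have "w y x \<in> nb u - nb y"
        by blast
      then show ?thesis
        by simp
    qed
    define route where "route e p \<longleftrightarrow>
        (\<exists>a b. a \<in> S \<and> b \<in> S \<and> a \<noteq> b \<and> \<not> E a b \<and> e = {a, b} \<and> p = [a, b]) \<or>
        (\<exists>y x. y \<in> T \<and> E v x \<and> E y x \<and> e = {y, x} \<and> p = [y, w y x, q y, x])" for e p
    have T_indep: "\<not> E y z" if "y \<in> T" "z \<in> T" for y z
      using indep[of y z] T(1) that unfolding C_def by blast
    have S_I: "S \<inter> nb u = {}"
      using disj TI by (auto simp: S_def)
    have ex: "\<exists>p. route e p" if "e \<in> pairs S" for e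
    proof -
      obtain a b where ab: "e = {a, b}" "a \<in> S" "b \<in> S" "a \<noteq> b"
        using \<open>e \<in> pairs S\<close> by (auto simp: pairs_def)
      show ?thesis
      proof (cases "E a b")
        case False
        with ab show ?thesis
          unfolding route_def by blast
      next
        case True
        then consider "a \<in> T" "E v b" | "b \<in> T" "E v a"
          using ab T_indep no_triangle[of v a b] by (auto simp: S_def)
        then show ?thesis
        proof cases
          case 1
          with True ab(1) show ?thesis
            unfolding route_def by blast
        next
          case 2
          with E_sym[OF True] ab(1) show ?thesis
            unfolding route_def by (metis insert_commute)
        qed
      qed
    qed
    have path: "p \<noteq> [] \<and> distinct p \<and> set p \<subseteq> V \<and> successively (\<lambda>x y. \<not> E x y) p \<and>
        {hd p, last p} = e \<and> internal_verts p \<inter> S = {}" if "route e p" for e p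
      using that unfolding route_def
    proof (elim disjE exE conjE)
      fix a b
      assume "a \<in> S" "b \<in> S" "a \<noteq> b" "\<not> E a b" "e = {a, b}" "p = [a, b]"
      then show ?thesis
        using \<open>S \<subseteq> V\<close> by (auto simp: internal_verts_def)
    next
      fix y x
      assume yx: "y \<in> T" "E v x" "E y x" "e = {y, x}" "p = [y, w y x, q y, x]"
      have "E u (w y x)" "\<not> E y (w y x)" "E u (q y)" "E y (q y)"
        using w q yx by auto
      \<comment> \<open>\<open>w y x\<close> and \<open>q y\<close> share the neighbour
        \<open>u\<close>, and \<open>q y\<close> and \<open>x\<close> share \<open>y\<close>, so
        triangle-freeness makes both pairs nonadjacent.\<close>
      moreover from this have "\<not> E (w y x) (q y)" "\<not> E (q y) x"
        using no_triangle[of u "w y x" "q y"] no_triangle[of y "q y" x] yx by auto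
      moreover have "y \<in> S" "x \<in> S"
        using yx by (auto simp: S_def)
      moreover from calculation have "w y x \<notin> S" "q y \<notin> S" "w y x \<noteq> q y" "y \<noteq> x"
        using S_I yx by auto
      moreover have "y \<in> V" "x \<in> V" "w y x \<in> V" "q y \<in> V"
        using calculation \<open>S \<subseteq> V\<close> E_V'[of u] by auto
      ultimately show ?thesis
        using yx by (auto simp: internal_verts_def)
    qed
    have edges_direct: "path_edges [a, b] = {{a, b}}"
      and edges_long: "path_edges [a, b, c, d] = {{a, b}, {b, c}, {c, d}}" for a b c d :: 'a
      by (auto simp: path_edges_def undirect_def)
    have disjoint: "path_edges p \<inter> path_edges p' = {}" if "route e p" "route f p'" "e \<noteq> f" for e f p p'
    proof -
      have long_long: "path_edges [y, w y x, q y, x] \<inter> path_edges [y', w y' x', q y', x'] = {}"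
        if yx: "y \<in> T" "E v x" "E y x" and yx': "y' \<in> T" "E v x'" "E y' x'"
          and ne: "{y, x} \<noteq> {y', x'}" for y x y' x'
      proof -
        have I: "w y x \<in> nb u" "w y' x' \<in> nb u" "q y \<in> nb u" "q y' \<in> nb u"
          using w q yx yx' by auto
        have nI: "y \<notin> nb u" "y' \<notin> nb u" "x \<notin> nb u" "x' \<notin> nb u"
          using TI disj yx yx' by auto
        have sep: "y \<noteq> x'" "y' \<noteq> x"
          using TA yx yx' by auto
        have 1: "w y x \<noteq> w y' x'" if "y = y'"
          using w_inj[OF yx(1)] yx yx' that ne by (auto simp: inj_on_def)
        have 2: "y = y'" if "q y = q y'"
          using q_inj yx yx' that by (auto simp: inj_on_def)
        \<comment> \<open>A middle edge used in opposite directions would put \<open>q y\<close>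
          only in the trace of \<open>y\<close> and \<open>q y'\<close> only in that of
          \<open>y'\<close>, against nesting.\<close>
        have 3: "\<not> (w y x = q y' \<and> q y = w y' x')"
        proof
          assume "w y x = q y' \<and> q y = w y' x'"
          then have "\<not> E y (q y')" "\<not> E y' (q y)"
            using w[OF yx(1,2,3)] w[OF yx'(1,2,3)] by simp_all
          then show False
            using nested[OF yx(1) yx'(1)] q[OF yx(1)] q[OF yx'(1)]
            unfolding subset_iff Int_iff in_nb by blast
        qed
        show ?thesis
          unfolding edges_long
          by (rule three_edge_paths_disjoint[OF I nI sep]) (use 1 2 3 ne in blast)+
      qed
      \<comment> \<open>Every edge of a long path has an end in \<open>nb u\<close>, while a direct
        edge stays inside \<open>S\<close>.\<close>
      have direct_long: "path_edges [a, b] \<inter> path_edges [y, w y x, q y, x] = {}"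
        if "a \<in> S" "b \<in> S" "y \<in> T" "E v x" "E y x" for a b y x
        unfolding edges_direct edges_long using that w[of y x] q[of y] S_I
        by (auto simp: doubleton_eq_iff)
      have direct_direct: "path_edges [a, b] \<inter> path_edges [a', b'] = {}" if "{a, b} \<noteq> {a', b'}"
        for a b a' b' :: 'a
        unfolding edges_direct using that by auto
      show ?thesis
        using that(1) unfolding route_def
      proof (elim disjE exE conjE)
        fix a b
        assume ab: "a \<in> S" "b \<in> S" "e = {a, b}" "p = [a, b]"
        show ?thesis
          using that(2) unfolding route_def
        proof (elim disjE exE conjE)
          fix a' b'
          assume "f = {a', b'}" "p' = [a', b']"
          with ab direct_direct[of a b a' b'] \<open>e \<noteq> f\<close> show ?thesis
            by simp
        next
          fix y x
          assume "y \<in> T" "E v x" "E y x" "p' = [y, w y x, q y, x]"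
          with ab direct_long[of a b y x] show ?thesis
            by simp
        qed
      next
        fix y x
        assume yx: "y \<in> T" "E v x" "E y x" "e = {y, x}" "p = [y, w y x, q y, x]"
        show ?thesis
          using that(2) unfolding route_def
        proof (elim disjE exE conjE)
          fix a b
          assume "a \<in> S" "b \<in> S" "p' = [a, b]"
          with yx direct_long[of a b y x] show ?thesis
            by (simp add: Int_commute)
        next
          fix y' x'
          assume "y' \<in> T" "E v x'" "E y' x'" "f = {y', x'}" "p' = [y', w y' x', q y', x']"
          with yx long_long[of y x y' x'] \<open>e \<noteq> f\<close> show ?thesis
            by simp
        qed
      qed
    qed
    from ex have "\<forall>e\<in>pairs S. \<exists>p. route e p"
      by blast
    then obtain P where "\<forall>e\<in>pairs S. route e (P e)"
      by (rule bchoice[THEN exE])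
    then have P: "route e (P e)" if "e \<in> pairs S" for e
      using that by blast
    show ?thesis
      unfolding linked_def
      by (rule exI[of _ P], intro conjI ballI impI; (rule disjoint | insert path[OF P])?)
        (simp_all add: P)
  qed
  ultimately show ?thesis
    by blast
qed

end

section \<open>Maximum matchings\<close>

context triangle_free
begin

text \<open>A matching is an involution of \<open>V\<close>; its fixed points are the unmatched vertices.\<close>

definition matching :: "('a \<Rightarrow> 'a) \<Rightarrow> bool" where
  "matching m \<longleftrightarrow> (\<forall>x\<in>V. m x \<in> V \<and> m (m x) = x \<and> (m x = x \<or> E x (m x)))"

definition unmatched :: "('a \<Rightarrow> 'a) \<Rightarrow> 'a set" where
  "unmatched m = {x \<in> V. m x = x}"

definition maximum_matching :: "('a \<Rightarrow> 'a) \<Rightarrow> bool" where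
  "maximum_matching m \<longleftrightarrow>
     matching m \<and> (\<forall>m'. matching m' \<longrightarrow> card (unmatched m) \<le> card (unmatched m'))"

lemma exists_maximum_matching: "\<exists>m. maximum_matching m"
proof -
  have "matching id"
    by (simp add: matching_def)
  from ex_has_least_nat[of matching, OF this, of "\<lambda>m. card (unmatched m)"] show ?thesis
    unfolding maximum_matching_def by blast
qed

lemma finite_unmatched [simp]: "finite (unmatched m)"
  using finite_V by (simp add: unmatched_def)

lemma unmatched_nonadjacent:
  assumes "maximum_matching m" "x \<in> unmatched m" "y \<in> unmatched m"
  shows "\<not> E x y"
proof
  assume e: "E x y"
  then have ne: "x \<noteq> y"
    by auto
  have mm: "m z \<in> V" "m (m z) = z" "m z = z \<or> E z (m z)" if "z \<in> V" for z
    using assms(1) that unfolding maximum_matching_def matching_def by blast+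
  have fixed: "x \<in> V" "m x = x" "y \<in> V" "m y = y"
    using assms(2,3) by (auto simp: unmatched_def)
  have "matching (m(x := y, y := x))"
    unfolding matching_def
  proof
    fix z
    assume z: "z \<in> V"
    consider "z = x" | "z = y" | "z \<noteq> x" "z \<noteq> y"
      by blast
    then show "(m(x := y, y := x)) z \<in> V \<and>
        (m(x := y, y := x)) ((m(x := y, y := x)) z) = z \<and>
        ((m(x := y, y := x)) z = z \<or> E z ((m(x := y, y := x)) z))"
    proof cases
      case 3
      then have "m z \<noteq> x" "m z \<noteq> y"
        using mm(2)[OF z] fixed by auto
      with 3 show ?thesis
        using mm[OF z] by simp
    qed (use e E_sym[OF e] ne fixed in simp_all)
  qed
  moreover have "unmatched (m(x := y, y := x)) = unmatched m - {x, y}"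
    using ne by (auto simp: unmatched_def)
  then have "card (unmatched (m(x := y, y := x))) < card (unmatched m)"
    using assms(2) by (intro psubset_card_mono finite_unmatched) auto
  ultimately show False
    using assms(1) unfolding maximum_matching_def by (meson leD)
qed

text \<open>Exchanging along an alternating path of length two moves the unmatched vertex \<open>x\<close>. Longer
  augmenting paths are handled by iterating this.\<close>

lemma rotate:
  assumes m: "maximum_matching m" and x: "x \<in> unmatched m" and e: "E x a"
  obtains m' where "maximum_matching m'" "unmatched m' = insert (m a) (unmatched m - {x})"
    "\<And>z. z \<notin> {x, a, m a} \<Longrightarrow> m' z = m z"
proof -
  \<comment> \<open>The last update makes the former partner of \<open>a\<close> a fixed
    point.\<close>
  define m' where "m' = m(x := a, a := x, m a := m a)"
  have V: "a \<in> V" "x \<in> V"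
    using e E_V E_V' by blast+
  have mm: "m z \<in> V" "m (m z) = z" "m z = z \<or> E z (m z)" if "z \<in> V" for z
    using m that unfolding maximum_matching_def matching_def by blast+
  have mx: "m x = x"
    using x by (simp add: unmatched_def)
  have ma: "m a \<noteq> a"
    using unmatched_nonadjacent[OF m x, of a] e V by (auto simp: unmatched_def)
  have ne: "x \<noteq> a" "m a \<noteq> x"
    using e mm(2)[OF V(1)] mx by auto
  have other: "m z \<notin> {x, a, m a}" if "z \<in> V" "z \<notin> {x, a, m a}" for z
    using mm(2) that V mx by (metis insert_iff singletonD)
  have m'_eq: "m' x = a" "m' a = x" "m' (m a) = m a" "\<And>z. z \<notin> {x, a, m a} \<Longrightarrow> m' z = m z"
    using ma ne by (auto simp: m'_def)
  have "matching m'"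
    unfolding matching_def
  proof
    fix z
    assume z: "z \<in> V"
    consider "z = x" | "z = a" | "z = m a" | "z \<notin> {x, a, m a}"
      by blast
    then show "m' z \<in> V \<and> m' (m' z) = z \<and> (m' z = z \<or> E z (m' z))"
    proof cases
      case 4
      then show ?thesis
        using mm[OF z] other[OF z 4] m'_eq(4) by simp
    qed (use m'_eq V e E_sym[OF e] mm(1) in simp_all)
  qed
  moreover have un: "unmatched m' = insert (m a) (unmatched m - {x})"
  proof -
    have "z \<in> unmatched m' \<longleftrightarrow> z \<in> insert (m a) (unmatched m - {x})" for z
    proof -
      consider "z = x" | "z = a" | "z = m a" | "z \<notin> {x, a, m a}"
        by blast
      then show ?thesis
      proof cases
        case 4
        then show ?thesis
          using m'_eq(4)[OF 4] by (simp add: unmatched_def)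
      qed (use m'_eq V ne ma mm(1) in \<open>auto simp: unmatched_def\<close>)
    qed
    then show ?thesis
      by blast
  qed
  moreover have "card (unmatched m') = card (unmatched m)"
  proof -
    have "m a \<notin> unmatched m"
      using mm(2)[OF V(1)] ma by (simp add: unmatched_def)
    then show ?thesis
      using un card_Suc_Diff1[OF finite_unmatched x] by simp
  qed
  ultimately have "maximum_matching m'"
    using m unfolding maximum_matching_def by simp
  with un m'_eq(4) that show ?thesis
    by blast
qed

text \<open>Rotating frees \<open>m a\<close> and keeps any other unmatched \<open>y\<close>
  unmatched. For \<open>y = x\<close> the edge would close the triangle \<open>x\<close>,
  \<open>a\<close>, \<open>m a\<close>.\<close>

lemma partner_nonadjacent:
  assumes m: "maximum_matching m" and x: "x \<in> unmatched m" "E x a" and y: "y \<in> unmatched m"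
  shows "\<not> E (m a) y"
proof (cases "y = x")
  case True
  have "m a = a \<or> E a (m a)"
    using m E_V'[OF x(2)] unfolding maximum_matching_def matching_def by blast
  moreover have "m a \<noteq> a"
    using unmatched_nonadjacent[OF m x(1), of a] x(2) E_V'[OF x(2)] by (auto simp: unmatched_def)
  ultimately show ?thesis
    using True no_triangle[OF x(2)] E_sym[of "m a" x] by blast
next
  case False
  obtain m' where m': "maximum_matching m'" "unmatched m' = insert (m a) (unmatched m - {x})"
    using rotate[OF m x] by metis
  then have "m a \<in> unmatched m'" "y \<in> unmatched m'"
    using y False by simp_all
  then show ?thesis
    by (rule unmatched_nonadjacent[OF m'(1)])
qed

text \<open>Rotating at both \<open>x\<close> and \<open>y\<close> frees \<open>m a\<close> and
  \<open>m b\<close> together, which excludes augmenting paths with five edges.\<close>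

lemma partners_nonadjacent:
  assumes m: "maximum_matching m" and x: "x \<in> unmatched m" "E x a"
    and y: "y \<in> unmatched m" "E y b" and ne: "x \<noteq> y"
  shows "\<not> E (m a) (m b)"
proof (cases "a = b")
  case False
  obtain m1 where m1: "maximum_matching m1" "unmatched m1 = insert (m a) (unmatched m - {x})"
    "\<And>z. z \<notin> {x, a, m a} \<Longrightarrow> m1 z = m z"
    using rotate[OF m x] by metis
  have "b \<noteq> m a" "b \<noteq> x"
    using partner_nonadjacent[OF m x y(1)] unmatched_nonadjacent[OF m y(1) x(1)] y(2) E_sym[OF y(2)]
    by blast+
  then have b: "m1 b = m b"
    using m1(3) False by blast
  have y1: "y \<in> unmatched m1"
    using m1(2) y(1) ne by blast
  obtain m2 where m2: "maximum_matching m2" "unmatched m2 = insert (m1 b) (unmatched m1 - {y})"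
    using rotate[OF m1(1) y1 y(2)] by metis
  have "m a \<noteq> y"
  proof
    assume "m a = y"
    then have "m a = a"
      using m y(1) E_V'[OF x(2)] unfolding maximum_matching_def matching_def unmatched_def by auto
    then show False
      using \<open>m a = y\<close> unmatched_nonadjacent[OF m x(1) y(1)] x(2) by simp
  qed
  then have "m a \<in> unmatched m2" "m b \<in> unmatched m2"
    using m1(2) m2(2) b by auto
  then show ?thesis
    using unmatched_nonadjacent[OF m2(1)] by blast
qed simp

end

section \<open>Matchings when all degrees exceed a third of the vertices\<close>

context dense_triangle_free
begin

text \<open>Each of the three sets holds more than a third of the vertices. \<open>A\<close> will be
  the image of a neighbourhood under the matching, so only its size is prescribed.\<close>

lemma no_three_disjoint:
  assumes "x \<in> V" "y \<in> V" "z \<in> V" "A \<subseteq> V" "card A = card (nb z)"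
    and "nb x \<inter> nb y = {}" "nb x \<inter> A = {}" "nb y \<inter> A = {}"
  shows False
proof -
  have "card (nb x \<union> nb y \<union> A) = card (nb x) + card (nb y) + card A"
    using assms(4,6-8) finite_V
    by (subst card_Un_disjoint) (auto simp: card_Un_disjoint intro: finite_subset)
  moreover have "card (nb x \<union> nb y \<union> A) \<le> card V"
    using assms(4) nb_subset finite_V by (intro card_mono) auto
  ultimately show False
    using dense[OF assms(1)] dense[OF assms(2)] dense[OF assms(3)] assms(5) by linarith
qed

text \<open>This is the Gallai-Edmonds structure of a graph with minimum degree above \<open>n / 3\<close>: the only
  obstruction to a near-perfect matching is an independent set.\<close>

lemma matching_dichotomy:
  assumes m: "maximum_matching m" and two: "\<not> card (unmatched m) \<le> 1"
  shows "\<exists>Y\<subseteq>V. (\<forall>x\<in>Y. \<forall>y\<in>Y. \<not> E x y) \<and> (\<forall>x\<in>V. x \<in> Y \<or> m x \<in> Y)"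
proof -
  \<comment> \<open>\<open>B\<close> collects the neighbours of unmatched vertices; \<open>Y\<close>
    consists of the unmatched vertices and the partners of \<open>B\<close>. The remainder
    \<open>L\<close> is matched within itself and has no neighbour in \<open>F\<close>.\<close>
  define F where "F = unmatched m"
  define B where "B = (\<Union>f\<in>F. nb f)"
  define Y where "Y = F \<union> m ` B"
  define L where "L = V - Y - B"
  have mm: "m z \<in> V" "m (m z) = z" "m z = z \<or> E z (m z)" if "z \<in> V" for z
    using m that unfolding maximum_matching_def matching_def by blast+
  have F_iff: "z \<in> F \<longleftrightarrow> z \<in> V \<and> m z = z" for z
    by (auto simp: F_def unmatched_def)
  have BV: "B \<subseteq> V" "m ` B \<subseteq> V"
    using nb_subset mm(1) by (auto simp: B_def)
  have YV: "Y \<subseteq> V"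
    using BV F_iff by (auto simp: Y_def)
  have FF: "\<not> E f g" if "f \<in> F" "g \<in> F" for f g
    using unmatched_nonadjacent[OF m] that by (simp add: F_def)
  have FP: "\<not> E (m a) g" "\<not> E g (m a)" if "f \<in> F" "E f a" "g \<in> F" for f g a
    using partner_nonadjacent[OF m] that E_sym[of g "m a"] by (auto simp: F_def)
  have PP: "\<not> E (m a) (m b)" if "f \<in> F" "E f a" "g \<in> F" "E g b" "f \<noteq> g" for f g a b
    using partners_nonadjacent[OF m] that by (simp add: F_def)
  have ex_other: "\<exists>g\<in>F. g \<noteq> f" for f
  proof (rule ccontr)
    assume "\<not> ?thesis"
    then have "F \<subseteq> {f}"
      by blast
    from card_mono[OF _ this] show False
      using two by (simp add: F_def)
  qed
  have m_nb: "m ` nb f \<subseteq> V" "card (m ` nb f) = card (nb f)" for f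
  proof -
    have "inj_on m V"
      by (rule inj_on_inverseI[of _ m]) (use mm(2) in blast)
    then show "card (m ` nb f) = card (nb f)"
      using nb_subset by (intro card_image) (rule inj_on_subset)
    show "m ` nb f \<subseteq> V"
      using mm(1) nb_subset by blast
  qed
  have triple: False if "E x y" "f \<in> F" "nb x \<inter> m ` nb f = {}" "nb y \<inter> m ` nb f = {}" for x y f
  proof (rule no_three_disjoint[of x y f "m ` nb f"])
    show "nb x \<inter> nb y = {}"
      using no_triangle[OF that(1)] by auto
    show "x \<in> V" "y \<in> V" "f \<in> V"
      using that(2) F_iff E_V[OF that(1)] E_V'[OF that(1)] by blast+
  qed (simp_all add: that m_nb)
  \<comment> \<open>\<open>PP\<close> requires distinct unmatched vertices. Applied with a second
    one, \<open>g\<close>, it shows that neither \<open>m a\<close> nor \<open>m b\<close> has a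
    neighbour in the image of \<open>nb g\<close>, contrary to \<open>triple\<close>.\<close>
  have PP': "\<not> E (m a) (m b)" if f: "f \<in> F" "E f a" "E f b" for f a b
  proof
    assume e: "E (m a) (m b)"
    obtain g where g: "g \<in> F" "g \<noteq> f"
      using ex_other by blast
    show False
    proof (rule triple[OF e g(1)])
      show "nb (m a) \<inter> m ` nb g = {}" "nb (m b) \<inter> m ` nb g = {}"
        using PP[OF f(1) _ g(1) _ g(2)[symmetric]] f by auto
    qed
  qed
  have *: "\<exists>f a. f \<in> F \<and> E f a \<and> x = m a" if "x \<in> m ` B" for x
  proof -
    from that obtain a where a: "a \<in> B" "x = m a"
      by (rule imageE)
    then obtain f where "f \<in> F" "E f a"
      unfolding B_def by auto
    with a(2) show ?thesis
      by blast
  qed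
  have Y_indep: "\<not> E x y" if xy: "x \<in> Y" "y \<in> Y" for x y
  proof -
    consider "x \<in> F" "y \<in> F" | "x \<in> F" "y \<in> m ` B" | "x \<in> m ` B" "y \<in> F"
      | "x \<in> m ` B" "y \<in> m ` B"
      using xy by (auto simp: Y_def)
    then show ?thesis
    proof cases
      case 1
      then show ?thesis
        by (rule FF)
    next
      case 2
      from *[OF 2(2)] obtain g b where "g \<in> F" "E g b" "y = m b"
        by blast
      with FP(2)[OF _ _ 2(1)] show ?thesis
        by blast
    next
      case 3
      from *[OF 3(1)] obtain f a where "f \<in> F" "E f a" "x = m a"
        by blast
      with FP(1)[OF _ _ 3(2)] show ?thesis
        by blast
    next
      case 4
      then obtain f a g b where "f \<in> F" "E f a" "x = m a" "g \<in> F" "E g b" "y = m b"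
        using *[of x] *[of y] by blast
      then show ?thesis
        using PP[of f a g b] PP'[of f a b] by blast
    qed
  qed
  have L: "l \<in> V" "m l \<in> L" "E l (m l)" "l \<notin> F" "m l \<noteq> l" if "l \<in> L" for l
  proof -
    show lV: "l \<in> V" and lF: "l \<notin> F"
      using that by (auto simp: L_def Y_def)
    then show "m l \<noteq> l"
      using F_iff by blast
    then show "E l (m l)"
      using mm(3)[OF lV] by blast
    have "m l \<notin> F"
      using F_iff mm(2)[OF lV] \<open>m l \<noteq> l\<close> by auto
    moreover have "m l \<notin> m ` B"
    proof
      assume "m l \<in> m ` B"
      then obtain b where b: "m l = m b" "b \<in> B"
        by (rule imageE)
      then have "l = b"
        using mm(2)[OF lV] mm(2)[of b] BV(1) by auto
      then show False
        using that b(2) by (simp add: L_def)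
    qed
    moreover have "m l \<notin> B"
    proof
      assume "m l \<in> B"
      then have "m (m l) \<in> m ` B"
        by (rule imageI)
      then show False
        using that mm(2)[OF lV] by (simp add: L_def Y_def)
    qed
    ultimately show "m l \<in> L"
      using mm(1)[OF lV] by (auto simp: L_def Y_def)
  qed
  have LB: "\<not> E f l" if "f \<in> F" "l \<in> L" for f l
    using that by (auto simp: L_def B_def)
  obtain f0 where f0: "f0 \<in> F"
    using ex_other by blast
  have f0Y: "m ` nb f0 \<subseteq> Y"
    using f0 by (auto simp: Y_def B_def)
  \<comment> \<open>The augmenting path is \<open>f, a, m a, l, m l, m b, b, g\<close>. Two
    rotations move the free vertex from \<open>f\<close> to \<open>m l\<close>, and a third moves
    the one at \<open>g\<close> to \<open>m b\<close>.\<close>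
  have augment: False
    if l: "l \<in> L" and f: "f \<in> F" "E f a" "E l (m a)" and g: "g \<in> F" "E g b" "E (m l) (m b)"
      and fg: "f \<noteq> g" for l f g a b
  proof -
    have "a \<in> B" "b \<in> B"
      using f g by (auto simp: B_def)
    then have ab: "a \<in> B" "m a \<in> Y" "b \<in> B" "m b \<in> Y"
      by (simp_all add: Y_def)
    have lY: "l \<notin> Y" "l \<notin> B" "m l \<notin> Y" "m l \<notin> B"
      using l L(2)[OF l] by (auto simp: L_def)
    obtain m1 where m1: "maximum_matching m1" "unmatched m1 = insert (m a) (F - {f})"
      "\<And>z. z \<notin> {f, a, m a} \<Longrightarrow> m1 z = m z"
      using rotate[OF m f(1)[unfolded F_def] f(2)] unfolding F_def by blast
    have "m1 l = m l"
      using m1(3)[of l] ab lY L(4)[OF l] f(1) by auto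
    moreover have am: "m a \<in> unmatched m1"
      using m1(2) by simp
    ultimately obtain m2 where m2: "maximum_matching m2"
      "unmatched m2 = insert (m l) (unmatched m1 - {m a})"
      "\<And>z. z \<notin> {m a, l, m l} \<Longrightarrow> m2 z = m1 z"
      using rotate[OF m1(1) am E_sym[OF f(3)]] by metis
    have nbm: "m a \<noteq> b" "b \<noteq> f" "m a \<noteq> g" "a \<noteq> b"
    proof -
      show "m a \<noteq> b"
        using FP(2)[OF f(1,2) g(1)] g(2) by blast
      show "b \<noteq> f"
        using FF[OF g(1) f(1)] g(2) by blast
      show "m a \<noteq> g"
        using LB[OF g(1) l] E_sym[OF f(3)] by blast
      show "a \<noteq> b"
        using no_triangle[OF L(3)[OF l] g(3)] f(3) by blast
    qed
    have "m2 b = m b"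
      using m1(3)[of b] m2(3)[of b] nbm ab lY by auto
    moreover have gm: "g \<in> unmatched m2"
      using m2(2) m1(2) g(1) fg nbm by auto
    ultimately obtain m3 where m3: "maximum_matching m3"
      "unmatched m3 = insert (m b) (unmatched m2 - {g})"
      using rotate[OF m2(1) gm g(2)] by metis
    have "m l \<noteq> g"
      using L(4)[OF L(2)[OF l]] g(1) by blast
    then have "m l \<in> unmatched m3" "m b \<in> unmatched m3"
      using m2(2) m3(2) by auto
    then show False
      using unmatched_nonadjacent[OF m3(1)] g(3) by blast
  qed
  \<comment> \<open>An end of each matching edge in \<open>L\<close> must still join
    \<open>Y\<close>; \<open>Z\<close> holds the vertices of \<open>L\<close> that can.\<close>
  define Z where "Z = {l \<in> L. \<forall>y\<in>Y. \<not> E l y}"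
  have nbZ: "nb l \<inter> m ` nb f0 = {}" if "l \<in> Z" for l
    using that f0Y by (auto simp: Z_def)
  have Z_indep: "\<not> E x y" if "x \<in> Z" "y \<in> Z" for x y
    using triple[OF _ f0 nbZ[OF that(1)] nbZ[OF that(2)]] by (rule notI)
  have Z_or: "l \<in> Z \<or> m l \<in> Z" if l: "l \<in> L" for l
  proof (rule ccontr)
    assume "\<not> ?thesis"
    then have "\<exists>y\<in>Y. E l y" "\<exists>y\<in>Y. E (m l) y"
      using l L(2)[OF l] by (simp_all add: Z_def)
    then obtain y y' where y: "y \<in> Y" "E l y" and y': "y' \<in> Y" "E (m l) y'"
      by (elim bexE)
    have "y \<in> m ` B" if "y \<in> Y" "E l y" "l \<in> L" for y l
      using that LB[of y l] E_sym[OF that(2)] by (auto simp: Y_def)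
    note * = *[OF this]
    obtain f a where f: "f \<in> F" "E f a" "y = m a"
      using *[OF y l] by (elim exE conjE)
    obtain g b where g: "g \<in> F" "E g b" "y' = m b"
      using *[OF y' L(2)[OF l]] by (elim exE conjE)
    \<comment> \<open>Distinct unmatched ends would give an augmenting path. With
      \<open>f = g\<close>, the same argument for another \<open>h\<close> keeps \<open>l\<close>
      and \<open>m l\<close> nonadjacent to the partners of \<open>nb h\<close>, contrary to
      \<open>triple\<close>.\<close>
    have fg: "f = g"
      using augment[OF l f(1,2) _ g(1,2)] y(2) y'(2) unfolding f(3) g(3) by blast
    obtain h where h: "h \<in> F" "h \<noteq> f"
      using ex_other by blast
    show False
    proof (rule triple[OF L(3)[OF l] h(1)])
      show "nb l \<inter> m ` nb h = {}"
        using augment[OF l h(1) _ _ g(1,2)] h(2) fg g y' by auto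
      show "nb (m l) \<inter> m ` nb h = {}"
        using augment[OF l f(1,2) _ h(1)] h(2) f y by auto
    qed
  qed
  have "\<forall>x\<in>Y \<union> Z. \<forall>y\<in>Y \<union> Z. \<not> E x y"
  proof (intro ballI)
    fix x y
    assume "x \<in> Y \<union> Z" "y \<in> Y \<union> Z"
    moreover have "\<not> E z y" "\<not> E y z" if "z \<in> Z" "y \<in> Y" for y z
      using that E_sym[of y z] by (auto simp: Z_def)
    ultimately show "\<not> E x y"
      using Y_indep[of x y] Z_indep[of x y] by blast
  qed
  moreover have "x \<in> Y \<union> Z \<or> m x \<in> Y \<union> Z" if x: "x \<in> V" for x
    using x Z_or by (cases "x \<in> L") (auto simp: L_def Y_def)
  moreover have "Y \<union> Z \<subseteq> V"
    using YV by (auto simp: Z_def L_def)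
  ultimately show ?thesis
    by blast
qed

text \<open>The classes of \<open>f\<close> are the edges and fixed points of a maximum matching.
  With at most one fixed point there are at most half as many classes as vertices, rounded up;
  otherwise the independent set of \<open>matching_dichotomy\<close> meets every class.\<close>

lemma edge_partition:
  "\<exists>f :: 'a \<Rightarrow> 'a set. (\<forall>x\<in>V. \<forall>y\<in>V. f x = f y \<longrightarrow> x = y \<or> E x y) \<and>
     (card (f ` V) \<le> (card V + 1) div 2 \<or>
      (\<exists>Y\<subseteq>V. (\<forall>x\<in>Y. \<forall>y\<in>Y. \<not> E x y) \<and> card (f ` V) \<le> card Y))"
proof -
  obtain m where m: "maximum_matching m"
    using exists_maximum_matching by blast
  then have mm: "m z \<in> V" "m (m z) = z" "m z = z \<or> E z (m z)" if "z \<in> V" for z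
    using that unfolding maximum_matching_def matching_def by blast+
  define f where "f x = {x, m x}" for x
  have f_m: "f (m x) = f x" if "x \<in> V" for x
    using mm(2)[OF that] by (auto simp: f_def)
  have class_edge: "x = y \<or> E x y" if "x \<in> V" "y \<in> V" "f x = f y" for x y
    using that mm(3)[of x] by (auto simp: f_def doubleton_eq_iff)
  have small: "card (f ` V) \<le> (card V + 1) div 2" if one: "card (unmatched m) \<le> 1"
  proof -
    define W where "W = V - unmatched m"
    have W: "m x \<in> W \<and> m x \<noteq> x" if "x \<in> W" for x
      using that mm by (auto simp: W_def unmatched_def)
    have "2 * card (f ` W) = card (\<Union>(f ` W))"
    proof (rule card_partition)
      show "finite (f ` W)" "finite (\<Union>(f ` W))"
        using finite_V by (auto simp: W_def f_def)
      show "card c = 2" if "c \<in> f ` W" for c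
        using that W by (auto simp: f_def card_2_iff)
      show "c1 \<inter> c2 = {}" if c: "c1 \<in> f ` W" "c2 \<in> f ` W" "c1 \<noteq> c2" for c1 c2
      proof (rule ccontr)
        assume "c1 \<inter> c2 \<noteq> {}"
        then obtain z where z: "z \<in> c1" "z \<in> c2"
          by blast
        have *: "c = f z" if "c \<in> f ` W" "z \<in> c" for c
        proof -
          from that(1) obtain x where x: "x \<in> W" "c = f x"
            by blast
          then show ?thesis
            using that(2) f_m[of x] by (auto simp: f_def W_def)
        qed
        show False
          using *[OF c(1) z(1)] *[OF c(2) z(2)] c(3) by simp
      qed
    qed
    also have "\<Union>(f ` W) = W"
      using W by (auto simp: f_def)
    finally have "2 * card (f ` W) = card W" .
    moreover have "card W = card V - card (unmatched m)"
      unfolding W_def by (rule card_Diff_subset[OF finite_unmatched]) (auto simp: unmatched_def)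
    moreover have "card (unmatched m) \<le> card V"
      by (rule card_mono[OF finite_V]) (auto simp: unmatched_def)
    moreover have "f ` V = f ` W \<union> f ` unmatched m"
      by (auto simp: W_def unmatched_def)
    then have "card (f ` V) \<le> card (f ` W) + card (unmatched m)"
      using card_Un_le[of "f ` W" "f ` unmatched m"] card_image_le[of "unmatched m" f] by simp
    ultimately show ?thesis
      using one by linarith
  qed
  have large: "\<exists>Y\<subseteq>V. (\<forall>x\<in>Y. \<forall>y\<in>Y. \<not> E x y) \<and> card (f ` V) \<le> card Y"
    if two: "\<not> card (unmatched m) \<le> 1"
  proof -
    obtain Y where Y: "Y \<subseteq> V" "\<forall>x\<in>Y. \<forall>y\<in>Y. \<not> E x y" "\<forall>x\<in>V. x \<in> Y \<or> m x \<in> Y"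
      using matching_dichotomy[OF m two] by blast
    have "f x \<in> f ` Y" if "x \<in> V" for x
      using Y(3) that f_m[OF that] imageI[of x Y f] imageI[of "m x" Y f] by auto
    then have "f ` V \<subseteq> f ` Y"
      by blast
    moreover have "finite Y"
      using Y(1) finite_V by (rule finite_subset)
    ultimately have "card (f ` V) \<le> card Y"
      using card_mono[of "f ` Y" "f ` V"] card_image_le[of Y f] by simp
    with Y show ?thesis
      by blast
  qed
  show ?thesis
    by (intro exI[of _ f] conjI ballI impI class_edge) (use small large in \<open>assumption | argo\<close>)+
qed

end

section \<open>Immersions of complete graphs\<close>

lemma set_vwalk_arcs_subset:
  assumes "distinct p" "successively R p"
  shows "set (vwalk_arcs p) \<subseteq> {(x, y). x \<in> set p \<and> y \<in> set p \<and> x \<noteq> y \<and> R x y}"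
  using assms by (induction p rule: vwalk_arcs.induct) auto

lemma edges_complete_graph: "edges (complete_graph k) = pairs {..<k}"
  unfolding edges_def complete_graph_def pairs_def undirect_def by force

lemma (in triangle_free) independent_linked:
  assumes S: "S \<subseteq> V" and indep: "\<And>x y. x \<in> S \<Longrightarrow> y \<in> S \<Longrightarrow> \<not> E x y"
  shows "linked S"
proof -
  have "\<forall>e\<in>pairs S. \<exists>p. \<exists>a b. a \<in> S \<and> b \<in> S \<and> a \<noteq> b \<and> e = {a, b} \<and> p = [a, b]"
    by (auto simp: pairs_def)
  then obtain P where
    "\<forall>e\<in>pairs S. \<exists>a b. a \<in> S \<and> b \<in> S \<and> a \<noteq> b \<and> e = {a, b} \<and> P e = [a, b]"
    by (rule bchoice[THEN exE])
  then have P: "\<exists>a b. a \<in> S \<and> b \<in> S \<and> a \<noteq> b \<and> e = {a, b} \<and> P e = [a, b]" if "e \<in> pairs S" for e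
    using that by blast
  have path: "P e \<noteq> [] \<and> distinct (P e) \<and> set (P e) \<subseteq> V \<and>
      successively (\<lambda>x y. \<not> E x y) (P e) \<and> {hd (P e), last (P e)} = e \<and>
      internal_verts (P e) \<inter> S = {}" and edges: "path_edges (P e) = {e}" if e: "e \<in> pairs S" for e
  proof -
    obtain a b where ab: "a \<in> S" "b \<in> S" "a \<noteq> b" "e = {a, b}" "P e = [a, b]"
      using P[OF e] by blast
    have "a \<in> V" "b \<in> V" "\<not> E a b"
      using S indep ab(1,2) by auto
    with ab show "P e \<noteq> [] \<and> distinct (P e) \<and> set (P e) \<subseteq> V \<and>
      successively (\<lambda>x y. \<not> E x y) (P e) \<and> {hd (P e), last (P e)} = e \<and>
      internal_verts (P e) \<inter> S = {}"
      by (simp add: internal_verts_def)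
    show "path_edges (P e) = {e}"
      using ab by (simp add: path_edges_def undirect_def)
  qed
  show ?thesis
    unfolding linked_def
    by (rule exI[of _ P], rule conjI; intro ballI impI; (rule path; assumption)?) (simp add: edges)
qed

text \<open>Any \<open>k\<close> elements of \<open>S\<close> serve as branch vertices.
  \<open>I\<close> is their union with the paths between them, so every symmetric subgraph carrying
  the same data contains it, which gives minimality.\<close>

lemma (in triangle_free) contains_strong_immersion_complete_graph:
  assumes G: "pair_graph G" "pverts G = V"
    and adj: "\<And>x y. x \<in> V \<Longrightarrow> y \<in> V \<Longrightarrow> x \<noteq> y \<Longrightarrow> \<not> E x y \<Longrightarrow> (x, y) \<in> parcs G"
    and S: "S \<subseteq> V" "linked S" "k \<le> card S"
  shows "contains_strong_immersion G (complete_graph k)"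
proof -
  interpret G: pair_graph G
    by (rule G)
  obtain P where P: "\<And>e. e \<in> pairs S \<Longrightarrow> P e \<noteq> [] \<and> distinct (P e) \<and> set (P e) \<subseteq> V \<and>
        successively (\<lambda>x y. \<not> E x y) (P e) \<and> {hd (P e), last (P e)} = e \<and>
        internal_verts (P e) \<inter> S = {}"
    and P_disj: "\<And>e f. e \<in> pairs S \<Longrightarrow> f \<in> pairs S \<Longrightarrow> e \<noteq> f \<Longrightarrow>
        path_edges (P e) \<inter> path_edges (P f) = {}"
    using S(2) unfolding linked_def by (elim exE conjE) blast
  have "finite S"
    using S(1) finite_V by (rule finite_subset)
  then obtain i :: "nat \<Rightarrow> 'a" where i: "inj_on i {..<k}" "i ` {..<k} \<subseteq> S"
    using card_le_inj[of "{..<k}" S] S(3) by auto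
  define K where "K = edges (complete_graph k)"
  define Q where "Q e = P (i ` e)" for e
  have K: "i ` e \<in> pairs S" if "e \<in> K" for e
  proof -
    from that obtain a b where ab: "e = {a, b}" "a < k" "b < k" "a \<noteq> b"
      unfolding K_def edges_complete_graph pairs_def by auto
    then have "i a \<noteq> i b" "i a \<in> S" "i b \<in> S"
      using i by (auto simp: inj_on_def)
    with ab(1) show ?thesis
      by (auto simp: pairs_def)
  qed
  have K_sub: "e \<subseteq> {..<k}" if "e \<in> K" for e
    using that unfolding K_def edges_complete_graph pairs_def by auto
  have K_fin: "finite K"
    by (rule finite_subset[of _ "Pow {..<k}"]) (use K_sub in auto)
  have Q: "Q e \<noteq> []" "distinct (Q e)" "set (Q e) \<subseteq> V" "{hd (Q e), last (Q e)} = i ` e"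
    "internal_verts (Q e) \<inter> S = {}" "successively (\<lambda>x y. \<not> E x y) (Q e)" if "e \<in> K" for e
    using P[OF K[OF that]] by (simp_all add: Q_def)
  have arcs: "x \<in> set (Q e)" "y \<in> set (Q e)" "x \<noteq> y" "(x, y) \<in> parcs G" "(y, x) \<in> parcs G"
    if "e \<in> K" "(x, y) \<in> set (vwalk_arcs (Q e))" for e x y
  proof -
    have *: "x \<in> set (Q e) \<and> y \<in> set (Q e) \<and> x \<noteq> y \<and> \<not> E x y"
      using set_vwalk_arcs_subset[OF Q(2,6)[OF that(1)]] that(2) by blast
    then show "x \<in> set (Q e)" "y \<in> set (Q e)" "x \<noteq> y"
      by simp_all
    have "x \<in> V" "y \<in> V"
      using * Q(3)[OF that(1)] by auto
    then show "(x, y) \<in> parcs G" "(y, x) \<in> parcs G"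
      using * adj E_sym[of y x] by auto
  qed
  define A where "A = (\<Union>e\<in>K. set (vwalk_arcs (Q e)))"
  \<comment> \<open>The image of \<open>i\<close> is listed separately because there are no paths
    for \<open>k = 1\<close>. Adding the converse of \<open>A\<close> makes the arcs
    symmetric.\<close>
  define I where "I = \<lparr>pverts = i ` {..<k} \<union> (\<Union>e\<in>K. set (Q e)), parcs = A \<union> A\<inverse>\<rparr>"
  have I_simps: "pverts I = i ` {..<k} \<union> (\<Union>e\<in>K. set (Q e))" "parcs I = A \<union> A\<inverse>"
    by (simp_all add: I_def)
  have A: "x \<noteq> y \<and> x \<in> pverts I \<and> y \<in> pverts I \<and> (x, y) \<in> parcs G \<and> (y, x) \<in> parcs G"
    if "(x, y) \<in> A" for x y
  proof -
    from that obtain e where "e \<in> K" "(x, y) \<in> set (vwalk_arcs (Q e))"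
      unfolding A_def by blast
    with arcs[OF this] show ?thesis
      unfolding I_simps by blast
  qed
  have pg: "pair_graph I"
  proof
    show "fst e \<in> pverts I" "snd e \<in> pverts I" "fst e \<noteq> snd e" if "e \<in> parcs I" for e
      using that A[of "fst e" "snd e"] A[of "snd e" "fst e"] by (auto simp: I_simps(2))
    show "finite (pverts I)" "finite (parcs I)"
      using K_fin by (auto simp: I_simps A_def)
    show "symmetric I"
      by (auto simp: symmetric_def I_simps(2) sym_def)
  qed
  have sub: "subgraph I G"
    unfolding subgraph_def compatible_def
  proof (intro conjI)
    show "verts I \<subseteq> verts G"
      using i(2) S(1) Q(3) unfolding with_proj_simps I_simps G(2) by blast
    show "arcs I \<subseteq> arcs G"
      using A by (auto simp: I_simps(2))
    show "wf_digraph I" "wf_digraph G"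
      using pg G(1) by (simp_all add: wf_digraph_wp_iff pair_graph_def pair_digraph_def pair_fin_digraph_def)
  qed simp_all
  have sys: "immersion_system (complete_graph k) I i Q"
    unfolding immersion_system_def
  proof (intro conjI ballI impI)
    show "inj_on i (pverts (complete_graph k))" "i ` pverts (complete_graph k) \<subseteq> pverts I"
      using i(1) by (simp_all add: complete_graph_def I_simps)
    fix e
    assume e: "e \<in> edges (complete_graph k)"
    show "vpath (Q e) I"
      unfolding vpath_def vwalk_def
      using e Q(1,2)[of e] by (auto simp: I_simps A_def K_def)
    show "{hd (Q e), last (Q e)} = i ` e"
      using Q(4)[of e] e by (simp add: K_def)
    fix f
    assume f: "f \<in> edges (complete_graph k)" "e \<noteq> f"
    then have "i ` e \<noteq> i ` f"
      using inj_on_image_eq_iff[OF i(1), of e f] K_sub e unfolding K_def by blast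
    then show "path_edges (Q e) \<inter> path_edges (Q f) = {}"
      using P_disj K e f unfolding Q_def K_def by blast
  qed
  have min: "J = I" if J: "pair_graph J" "subgraph J I" "immersion_system (complete_graph k) J i Q"
    for J
  proof -
    interpret J: pair_graph J
      by (rule J)
    have path: "set (Q e) \<subseteq> pverts J \<and> set (vwalk_arcs (Q e)) \<subseteq> parcs J" if "e \<in> K" for e
      using J(3) that unfolding immersion_system_def vpath_def vwalk_def K_def by simp
    have "pverts I \<subseteq> pverts J"
      using J(3) path unfolding immersion_system_def I_simps complete_graph_def by auto
    moreover have "A \<subseteq> parcs J"
      using path unfolding A_def by blast
    then have "parcs I \<subseteq> parcs J"
      using J.pair_sym_arcs unfolding I_simps symmetric_def sym_def by auto
    moreover have "pverts J \<subseteq> pverts I" "parcs J \<subseteq> parcs I"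
      using J(2) by (simp_all add: subgraph_def)
    ultimately show ?thesis
      by (intro pair_pre_digraph.equality) auto
  qed
  have "internal_verts (Q e) \<inter> branch_vertices (complete_graph k) i = {}"
    if "e \<in> edges (complete_graph k)" for e
    using Q(5)[of e] i(2) that by (auto simp: branch_vertices_def complete_graph_def K_def)
  then have "strong_immersion (complete_graph k) G I i Q"
    unfolding strong_immersion_def immersion_def using pg sub sys min by blast
  then show ?thesis
    unfolding contains_strong_immersion_def by blast
qed

lemma chromatic_number_le:
  assumes fin: "finite (pverts G)" and wf: "\<And>x y. (x, y) \<in> parcs G \<Longrightarrow> x \<in> pverts G \<and> y \<in> pverts G"
    and f: "\<And>x y. (x, y) \<in> parcs G \<Longrightarrow> f x \<noteq> f y"
  shows "chromatic_number G \<le> card (f ` pverts G)"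
proof -
  obtain h where h: "bij_betw h (f ` pverts G) {0..<card (f ` pverts G)}"
    using ex_bij_betw_finite_nat[of "f ` pverts G"] fin by blast
  have "proper_coloring G (card (f ` pverts G)) (h \<circ> f)"
    unfolding proper_coloring_def
  proof (intro conjI)
    have "(h \<circ> f) ` pverts G = h ` f ` pverts G"
      by (rule image_comp[symmetric])
    also have "\<dots> = {..<card (f ` pverts G)}"
      using h by (simp add: bij_betw_def lessThan_atLeast0)
    finally show "(h \<circ> f) ` pverts G \<subseteq> {..<card (f ` pverts G)}"
      by simp
    have "inj_on h (f ` pverts G)"
      using h by (simp add: bij_betw_def)
    then show "\<forall>(u, v)\<in>parcs G. (h \<circ> f) u \<noteq> (h \<circ> f) v"
      using wf f by (fastforce dest: inj_onD)
  qed
  then show ?thesis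
    unfolding chromatic_number_def by (intro Least_le) blast
qed

theorem theorem6:
  fixes G :: "'a pair_pre_digraph" and n :: nat
  assumes "pair_graph G"
    and "card (pverts G) = n"
    and "n \<ge> 11"
    and "independence_number G = 2"
    and "real (max_degree G) < 19 * real n / 29 - 1"
  shows "contains_strong_immersion G (complete_graph (chromatic_number G))"
proof -
  interpret G: pair_graph G
    by (rule assms(1))
  define V where "V = pverts G"
  define E where "E x y \<longleftrightarrow> x \<in> V \<and> y \<in> V \<and> x \<noteq> y \<and> (x, y) \<notin> parcs G" for x y
  have finV: "finite V"
    by (simp add: V_def G.pair_finite_verts)
  have arc_sym: "(y, x) \<in> parcs G" if "(x, y) \<in> parcs G" for x y
    using G.pair_sym_arcs that by (auto simp: symmetric_def sym_def)
  have arc_V: "x \<in> V" "y \<in> V" "x \<noteq> y" if "(x, y) \<in> parcs G" for x y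
    using G.in_arcsD1[OF that] G.in_arcsD2[OF that] G.pair_no_loops[OF that] by (simp_all add: V_def)
  have indep2: "card S \<le> 2" if "independent_set G S" for S
  proof -
    have "finite {S. independent_set G S}"
      by (rule finite_subset[of _ "Pow V"]) (use finV in \<open>auto simp: independent_set_def V_def\<close>)
    then have "card S \<le> Max (card ` {S. independent_set G S})"
      using that by (intro Max_ge) auto
    then show ?thesis
      using assms(4) by (simp add: independence_number_def)
  qed
  interpret tf: triangle_free V E
  proof
    show "\<not> E x z" if "E x y" "E y z" for x y z
    proof
      assume "E x z"
      then have "independent_set G {x, y, z}"
        using that arc_sym arc_V(3) by (auto simp: independent_set_def E_def V_def)
      moreover have "card {x, y, z} = 3"
        using that \<open>E x z\<close> by (auto simp: E_def)
      ultimately show False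
        using indep2 by fastforce
    qed
  qed (use finV arc_sym in \<open>auto simp: E_def\<close>)
  have dense_29: "10 * card V < 29 * card (tf.nb x)" if x: "x \<in> V" for x
  proof -
    have "out_arcs G x = Pair x ` {y. (x, y) \<in> parcs G}"
      by (auto simp: out_arcs_def)
    then have deg: "out_degree G x = card {y. (x, y) \<in> parcs G}"
      by (simp add: out_degree_def card_image inj_on_def)
    have le: "out_degree G x \<le> max_degree G"
      unfolding max_degree_def using finV x by (intro Max_ge) (auto simp: V_def)
    have "tf.nb x = V - insert x {y. (x, y) \<in> parcs G}"
      using x by (auto simp: E_def)
    moreover have "insert x {y. (x, y) \<in> parcs G} \<subseteq> V"
      using x arc_V by blast
    moreover have "x \<notin> {y. (x, y) \<in> parcs G}"
      using arc_V(3)[of x x] by blast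
    moreover have "finite {y. (x, y) \<in> parcs G}"
      by (rule finite_subset[OF _ finV]) (use arc_V(2) in blast)
    ultimately have "card (tf.nb x) = card V - Suc (out_degree G x)"
      using finV deg by (simp add: card_Diff_subset finite_subset)
    \<comment> \<open>The degree hypothesis with denominators cleared. Complementary degrees are at
      least \<open>n - 1 - max_degree G\<close>, hence above \<open>10 n / 29\<close>.\<close>
    moreover have "29 * max_degree G + 29 < 19 * card V"
      using assms(2,5) by (simp add: V_def)
    ultimately show ?thesis
      using le by linarith
  qed
  interpret dense_triangle_free V E
    by unfold_locales (use dense_29 in fastforce)
  obtain f :: "'a \<Rightarrow> 'a set" where
    f: "\<forall>x\<in>V. \<forall>y\<in>V. f x = f y \<longrightarrow> x = y \<or> E x y"
    and dich: "card (f ` V) \<le> (card V + 1) div 2 \<or>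
      (\<exists>Y\<subseteq>V. (\<forall>x\<in>Y. \<forall>y\<in>Y. \<not> E x y) \<and> card (f ` V) \<le> card Y)"
    using edge_partition by blast
  have chi: "chromatic_number G \<le> card (f ` V)"
    unfolding V_def
  proof (rule chromatic_number_le)
    show "f x \<noteq> f y" if "(x, y) \<in> parcs G" for x y
      using that arc_V[OF that] f by (auto simp: E_def)
  qed (use finV arc_V in \<open>auto simp: V_def\<close>)
  have clique: ?thesis
    if "Y \<subseteq> V" "\<And>x y. x \<in> Y \<Longrightarrow> y \<in> Y \<Longrightarrow> \<not> E x y" "card (f ` V) \<le> card Y" for Y
    by (rule tf.contains_strong_immersion_complete_graph[OF assms(1) _ _ that(1) tf.independent_linked])
      (use that chi in \<open>auto simp: V_def E_def\<close>)
  show ?thesis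
  \<comment> \<open>The absence of a large clique of \<open>G\<close> serves twice: it selects the
    bound by half of the vertices, and it bounds the degrees of \<open>E'\<close>.\<close>
  proof (cases "\<exists>Y\<subseteq>V. (\<forall>x\<in>Y. \<forall>y\<in>Y. \<not> E x y) \<and> card (f ` V) \<le> card Y")
    case True
    then show ?thesis
      using clique by blast
  next
    case False
    then have half: "card (f ` V) \<le> (card V + 1) div 2"
      using dich by blast
    obtain E' where E': "maximal_triangle_free V E'" and sub: "\<And>x y. E x y \<Longrightarrow> E' x y"
      using tf.exists_maximal_triangle_free[OF dense_29] by blast
    interpret m: maximal_triangle_free V E'
      by (rule E')
    \<comment> \<open>A neighbourhood in \<open>E'\<close> is also independent in \<open>E\<close>,
      so one with half of the vertices would be the clique excluded in this case.\<close>
    have "2 * card (m.nb x) < card V" if "x \<in> V" for x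
    proof (rule ccontr)
      assume "\<not> ?thesis"
      then have "card (f ` V) \<le> card (m.nb x)"
        using half by linarith
      moreover have "\<not> E y z" if "y \<in> m.nb x" "z \<in> m.nb x" for y z
        using that m.no_triangle[of x y z] sub by auto
      ultimately have "m.nb x \<subseteq> V \<and> (\<forall>y\<in>m.nb x. \<forall>z\<in>m.nb x. \<not> E y z) \<and>
          card (f ` V) \<le> card (m.nb x)"
        using m.nb_subset by (intro conjI ballI) simp_all
      then have "\<exists>Y\<subseteq>V. (\<forall>x\<in>Y. \<forall>y\<in>Y. \<not> E x y) \<and> card (f ` V) \<le> card Y"
        by (rule exI[of _ "m.nb x"])
      with False show False
        by (rule notE)
    qed
    moreover have "V \<noteq> {}"
      using assms(2,3) by (auto simp: V_def)
    ultimately obtain S where S: "S \<subseteq> V" "card S = (card V + 1) div 2" "m.linked S"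
      using m.linked_half by blast
    show ?thesis
    proof (rule m.contains_strong_immersion_complete_graph[OF assms(1) _ _ S(1,3)])
      show "pverts G = V"
        by (simp add: V_def)
      show "(x, y) \<in> parcs G" if "x \<in> V" "y \<in> V" "x \<noteq> y" "\<not> E' x y" for x y
        using that sub[of x y] by (auto simp: E_def)
      show "chromatic_number G \<le> card S"
        using chi half S(2) by linarith
    qed
  qed
qed

end
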